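(* Let $s\in\mathbb N$ and $f\in C^\infty([0,1]^s)$ with $\mu=\int_{[0,1]^s}f$, and suppose that for some $K,\alpha>0$ and a finite collection $\mathcal J$ of subsets of $\{1,\dots,s\}$, $\|f^{|\boldsymbol\kappa|}\|_1\le K\alpha^{\|\boldsymbol\kappa\|_0}\max_{J\in\mathcal J}\prod_{j\in J}(|\kappa_j|)!$ for all $\boldsymbol k\in\mathbb N_0^s$. Let $\mathcal J_{\max}=\max_{J\in\mathcal J}|J|$ and $\lambda=3(\log2)^2/\pi^2$. Then for every $\gamma>0$ there exists a constant $\Gamma$ depending on $s,\alpha,\gamma,\mathcal J_{\max}$ such that under the complete random design $$\limsup_{m\to\infty}m^\gamma\Pr\Big(|\hat\mu_{m,\infty}-\mu|>K2^{-\lambda m^2/s+\Gamma m\log_2(m)}\Big)\le1.$$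
   Context: Binary digits: for $k\in\mathbb N_0$, $k=\sum_{\ell\ge1}a_\ell2^{\ell-1}$, $\kappa=\{\ell:a_\ell=1\}$; for $\boldsymbol k\in\mathbb N_0^s$ with digit sets $\boldsymbol\kappa=(\kappa_1,\dots,\kappa_s)$, $\|\boldsymbol\kappa\|_0=\sum_j|\kappa_j|$ and $f^{|\boldsymbol\kappa|}=\partial^{\|\boldsymbol\kappa\|_0}f/\partial x_1^{|\kappa_1|}\cdots\partial x_s^{|\kappa_s|}$; $\|\cdot\|_1$ the $L^1([0,1]^s)$ norm; empty products are $1$. Estimator: for $m\in\mathbb N$, $i\in\{0,\dots,2^m-1\}$ with binary digit vector $\vec i\in\{0,1\}^m$, random matrices $C_j\in\{0,1\}^{\infty\times m}$ ($j=1,\dots,s$) with all entries i.i.d. uniform on $\{0,1\}$ (complete random design), and digital shifts $\vec D_j\in\{0,1\}^\infty$ with i.i.d. uniform entries independent of the $C_j$; the point $\boldsymbol x_i$ has $j$-th coordinate with binary digit vector $C_j\vec i+\vec D_j\bmod2$; $\hat\mu_{m,\infty}=2^{-m}\sum_i f(\boldsymbol x_i)$. *)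

theory Defs
  imports "HOL-Analysis.Analysis" "HOL-Probability.Probability"
begin

text \<open>Coordinates of [0,1]^s are indexed by a finite linearly ordered type 'n, s = CARD('n);
  the order of 'n gives x_1,...,x_s.\<close>

definition upd_coord :: "real^'n \<Rightarrow> 'n \<Rightarrow> real \<Rightarrow> real^'n" where
  "upd_coord x j t = (\<chi> i. if i = j then t else x $ i)"

definition pd :: "'n \<Rightarrow> (real^'n \<Rightarrow> real) \<Rightarrow> real^'n \<Rightarrow> real" where
  "pd j g x = vector_derivative (\<lambda>t. g (upd_coord x j t)) (at (x $ j) within {0..1})"

definition smooth_cube :: "(real^'n \<Rightarrow> real) \<Rightarrow> bool" where
  "smooth_cube f \<longleftrightarrow> (\<forall>js::'n list.
      continuous_on (cbox 0 One) (foldr pd js f) \<and>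
      (\<forall>j. \<forall>x\<in>cbox 0 One.
          (\<lambda>t. foldr pd js f (upd_coord x j t)) differentiable (at (x $ j) within {0..1})))"

definition mixed_deriv :: "('n::{finite,linorder} \<Rightarrow> nat) \<Rightarrow> (real^'n::{finite,linorder} \<Rightarrow> real) \<Rightarrow> real^'n::{finite,linorder} \<Rightarrow> real" where
  "mixed_deriv k f = foldr (\<lambda>j h. (pd j ^^ k j) h) (sorted_list_of_set (UNIV::'n set)) f"

text \<open>Binary digit set kappa of k: positions l >= 1 with a_l = 1, k = sum a_l 2^(l-1).\<close>
definition digit_set :: "nat \<Rightarrow> nat set" where
  "digit_set k = {l. 1 \<le> l \<and> odd (k div 2 ^ (l - 1))}"

definition lam_const :: real where
  "lam_const = 3 * (ln 2)^2 / pi^2"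

definition coin :: "bool measure" where
  "coin = measure_pmf (pmf_of_set (UNIV::bool set))"

text \<open>Complete random design: C (j,l,c) is entry (l,c) of C_j (row l >= 1, column c, 0-based,
  only c < m used), D (j,l) is digit l of the shift D_j.  All i.i.d. uniform.\<close>
definition design_space :: "((('n \<times> nat \<times> nat) \<Rightarrow> bool) \<times> (('n \<times> nat) \<Rightarrow> bool)) measure" where
  "design_space = (PiM UNIV (\<lambda>_. coin)) \<Otimes>\<^sub>M (PiM UNIV (\<lambda>_. coin))"

text \<open>l-th binary digit (l >= 1) of coordinate j of point i: (C_j i + D_j) mod 2,
  where i has binary digit vector (i_0,...,i_{m-1}).\<close>
definition pt_digit :: "nat \<Rightarrow> (('n \<times> nat \<times> nat) \<Rightarrow> bool) \<Rightarrow> (('n \<times> nat) \<Rightarrow> bool) \<Rightarrow> nat \<Rightarrow> 'n \<Rightarrow> nat \<Rightarrow> bool" where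
  "pt_digit m C D i j l = (D (j, l) \<noteq> odd (card {c. c < m \<and> C (j, l, c) \<and> odd (i div 2 ^ c)}))"

definition design_point :: "nat \<Rightarrow> (('n::finite \<times> nat \<times> nat) \<Rightarrow> bool) \<Rightarrow> (('n \<times> nat) \<Rightarrow> bool) \<Rightarrow> nat \<Rightarrow> real^'n" where
  "design_point m C D i = (\<chi> j. (\<Sum>l. (if pt_digit m C D i j (Suc l) then 1 else 0) / 2 ^ Suc l))"

definition mu_hat :: "(real^'n::finite \<Rightarrow> real) \<Rightarrow> nat \<Rightarrow> (('n \<times> nat \<times> nat) \<Rightarrow> bool) \<Rightarrow> (('n \<times> nat) \<Rightarrow> bool) \<Rightarrow> real" where
  "mu_hat f m C D = (\<Sum>i<2^m. f (design_point m C D i)) / 2 ^ m"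

end

theory Submission
  imports Defs
begin

text \<open>
  Truncate all digits at level \<open>L\<close> and expand the cell averages of \<open>f\<close> in Walsh functions, indexed by
  finite sets \<open>A\<close> of pairs (coordinate, digit position). Averaging over the digital net keeps exactly
  those \<open>A\<close> that are annihilated by the random matrices, so the error is at most the sum of
  \<open>|walsh f A|\<close> over annihilated \<open>A \<noteq> {}\<close>. A Walsh coefficient is an integral of an iterated
  difference with steps \<open>2^-l\<close>, hence at most \<open>2^-N(A)\<close> times the \<open>L^1\<close> norm of the mixed derivative,
  where \<open>N(A)\<close> is the sum of the positions in \<open>A\<close>.

  Each \<open>A \<noteq> {}\<close> is annihilated with probability \<open>2^-m\<close>, and Euler's bound
  \<open>\<Sum>A. exp (-t N(A)) = (\<Prod>l. 1 + exp (-t l))^s \<le> exp (s \<pi>^2 / (12 t))\<close> with \<open>t = s \<pi>^2 / (6 m ln 2)\<close>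
  shows that with probability at least \<open>1 - m^-\<gamma>\<close> no \<open>A \<noteq> {}\<close> with
  \<open>N(A) \<le> T = \<lambda> m^2 / s - c m ln m\<close> is annihilated. The remaining tail is again estimated by Euler's
  bound, the factorials costing only a factor \<open>exp (O(m ln m))\<close> because \<open>|A|^2 \<le> 2 s N(A)\<close>.
\<close>

subsection \<open>Iterated differences\<close>

lemma mem_unit_cube: "(x::real^'n) \<in> cbox 0 One \<longleftrightarrow> (\<forall>i. 0 \<le> x$i \<and> x$i \<le> 1)"
proof -
  have "x \<in> cbox 0 One \<longleftrightarrow> (\<forall>b\<in>Basis. 0 \<le> x \<bullet> b \<and> x \<bullet> b \<le> 1)"
    by (simp add: mem_box)
  also have "\<dots> \<longleftrightarrow> (\<forall>i. 0 \<le> x \<bullet> axis i 1 \<and> x \<bullet> axis i 1 \<le> 1)"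
    by (auto simp: Basis_vec_def)
  finally show ?thesis by (simp add: inner_axis)
qed

definition digit_step :: "'n::finite \<times> nat \<Rightarrow> real^'n" where
  "digit_step p = axis (fst p) (1 / 2 ^ snd p)"

text \<open>Forward differences commute, but a list is used because each difference is later traded
  for a partial derivative, and these come in a fixed order: the head of the list is traded first,
  so the derivatives are read along \<open>rev (map fst P)\<close>.\<close>

fun iter_diff :: "('n::finite \<times> nat) list \<Rightarrow> (real^'n \<Rightarrow> real) \<Rightarrow> real^'n \<Rightarrow> real" where
  "iter_diff [] g x = g x"
| "iter_diff (p # P) g x = iter_diff P g (x + digit_step p) - iter_diff P g x"

lemma digit_step_nonneg: "0 \<le> digit_step p $ i"
  by (simp add: digit_step_def axis_def)

lemma sum_digit_step_nonneg: "0 \<le> sum_list (map digit_step P) $ i"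
  by (induction P) (simp_all add: digit_step_nonneg)

lemma continuous_on_axis:
  assumes "continuous_on S g"
  shows "continuous_on S (\<lambda>x. axis j (g x) :: real^'n)"
proof -
  have "continuous_on S (\<lambda>x. (\<chi> i. if i = j then g x else 0) :: real^'n)"
  proof (rule continuous_on_vec_lambda)
    fix i show "continuous_on S (\<lambda>x. if i = j then g x else 0)"
      using assms by (cases "i = j") auto
  qed
  then show ?thesis by (simp add: axis_def)
qed

lemma continuous_iter_diff:
  assumes "continuous_on UNIV g"
  shows "continuous_on UNIV (iter_diff P g)"
proof (induction P)
  case Nil
  have "iter_diff [] g = g" by (rule ext) simp
  then show ?case using assms by simp
next
  case (Cons p P)
  have "iter_diff (p # P) g = (\<lambda>x. iter_diff P g (x + digit_step p) - iter_diff P g x)" 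
    by (rule ext) simp
  moreover have "continuous_on UNIV (\<lambda>x. iter_diff P g (x + digit_step p))"
    by (rule continuous_on_compose2[OF Cons]) (auto intro!: continuous_intros)
  ultimately show ?case using Cons by (auto intro!: continuous_intros)
qed

text \<open>\<open>F js\<close> plays the role of the partial derivative of \<open>F []\<close> along \<open>js\<close> (last entry first), extended
  continuously to the whole space; the derivative is required on the cube only.\<close>

locale partial_family =
  fixes F :: "'n::finite list \<Rightarrow> real^'n \<Rightarrow> real"
  assumes cont: "continuous_on UNIV (F js)"
    and deriv: "x \<in> cbox 0 One \<Longrightarrow>
      ((\<lambda>t. F js (x + axis j t)) has_real_derivative F (j # js) x)
        (at 0 within {t. x + axis j t \<in> cbox 0 One})"
begin

text \<open>A difference is a linear combination of translates, so the derivative passes through it.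
  All steps are nonnegative, hence every evaluation point lies coordinatewise between
  \<open>x\<close> and the far corner; it is enough to have these two extremes in the cube.\<close>

lemma iter_diff_has_derivative:
  assumes "x \<in> cbox 0 One" "x + sum_list (map digit_step P) + axis j h \<in> cbox 0 One"
    and "0 \<le> t" "t \<le> h"
  shows "((\<lambda>t. iter_diff P (F js) (x + axis j t)) has_real_derivative
      iter_diff P (F (j # js)) (x + axis j t)) (at t within {0..h})"
  using assms(1,2)
proof (induction P arbitrary: x)
  case Nil
  have in_cube: "x + axis j u \<in> cbox 0 One" if "0 \<le> u" "u \<le> h" for u
    unfolding mem_unit_cube
  proof
    fix i
    have "0 \<le> x $ i" "x $ i \<le> 1" "0 \<le> x $ i + axis j h $ i" "x $ i + axis j h $ i \<le> 1"
      using Nil by (simp_all add: mem_unit_cube)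
    then show "0 \<le> (x + axis j u) $ i \<and> (x + axis j u) $ i \<le> 1"
      using that by (simp add: axis_def split: if_splits)
  qed
  have ax: "x + axis j t + axis j (u - t) = x + axis j u" for u
    by (simp add: vec_eq_iff axis_def)
  have "((\<lambda>u. F js (x + axis j t + axis j u)) has_real_derivative F (j # js) (x + axis j t))
      (at 0 within {u. x + axis j t + axis j u \<in> cbox 0 One})"
    by (rule deriv) (use in_cube assms in auto)
  \<comment> \<open>The derivative at parameter 0, based at \<open>x + axis j t\<close>, is carried
    to parameter \<open>t\<close> by the substitution \<open>u - t\<close>.\<close>
  then have "((\<lambda>u. F js (x + axis j t + axis j u)) has_real_derivative F (j # js) (x + axis j t))
      (at (t - t) within (\<lambda>u. u - t) ` {0..h})"
  proof (simp only: diff_self, elim DERIV_subset, safe)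
    fix u assume "u \<in> {0..h}"
    then show "x + axis j t + axis j (u - t) \<in> cbox 0 One" by (simp only: ax) (simp add: in_cube)
  qed
  then have "((\<lambda>u. F js (x + axis j t + axis j (u - t))) has_real_derivative F (j # js) (x + axis j t) * 1)
      (at t within {0..h})"
    by (rule DERIV_image_chain[unfolded o_def]) (auto intro!: derivative_eq_intros)
  then show ?case by (simp add: ax)
next
  case (Cons p P)
  have sw: "x + axis j u + digit_step p = x + digit_step p + axis j u" for u by simp
  have c1: "x + digit_step p \<in> cbox 0 One" "x + sum_list (map digit_step P) + axis j h \<in> cbox 0 One"
    unfolding mem_unit_cube
  proof (safe)
    fix i
    have *: "0 \<le> x $ i" "x $ i \<le> 1" 
      "x $ i + (digit_step p $ i + sum_list (map digit_step P) $ i) + axis j h $ i \<le> 1"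
      using Cons.prems by (simp_all add: mem_unit_cube)
    have **: "0 \<le> axis j h $ i" using assms by (simp add: axis_def)
    note *** = * ** sum_digit_step_nonneg[of P i] digit_step_nonneg[of p i]
    show "0 \<le> (x + digit_step p) $ i" "(x + digit_step p) $ i \<le> 1" 
      "0 \<le> (x + sum_list (map digit_step P) + axis j h) $ i"
      "(x + sum_list (map digit_step P) + axis j h) $ i \<le> 1" using *** by simp_all
  qed
  have c2: "x + digit_step p + sum_list (map digit_step P) + axis j h \<in> cbox 0 One"
    using Cons.prems(2) by (simp add: add.assoc)
  show ?case
    unfolding iter_diff.simps sw
    by (intro DERIV_diff Cons.IH Cons.prems(1) c1 c2)
qed

text \<open>Fundamental theorem of calculus along coordinate \<open>j\<close>: the outer difference
  becomes an integral of the derivative over an interval of length 2^-l.\<close>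

lemma iter_diff_bound_pointwise:
  assumes "x \<in> cbox 0 One" "x + sum_list (map digit_step ((j,l) # P)) \<in> cbox 0 One"
  shows "ennreal \<bar>iter_diff ((j,l) # P) (F js) x\<bar> \<le>
    (\<integral>\<^sup>+t. indicator {0..1/2^l} t * ennreal \<bar>iter_diff P (F (j # js)) (x + axis j t)\<bar> \<partial>lborel)"
proof -
  let ?h = "1/2^l :: real"
  have axis0: "axis j 0 = (0 :: real^'n)" by (simp add: vec_eq_iff axis_def)
  let ?g = "\<lambda>t. iter_diff P (F (j # js)) (x + axis j t)"
  have "has_bochner_integral lborel (\<lambda>t. indicator {0..?h} t *\<^sub>R ?g t) 
    (iter_diff P (F js) (x + axis j ?h) - iter_diff P (F js) (x + axis j 0))"
  proof (rule has_bochner_integral_FTC_Icc)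
    fix t assume "0 \<le> t" "t \<le> ?h"
    then show "((\<lambda>t. iter_diff P (F js) (x + axis j t)) has_vector_derivative ?g t) (at t within {0..?h})"
      unfolding has_real_derivative_iff_has_vector_derivative[symmetric]
      using assms by (intro iter_diff_has_derivative) (auto simp: digit_step_def algebra_simps)
  next
    have "continuous_on UNIV (\<lambda>t. x + axis j t)"
      by (intro continuous_intros continuous_on_axis)
    then show "continuous_on {0..?h} ?g"
      by (intro continuous_on_compose2[OF continuous_iter_diff[OF cont]])
        (auto intro: continuous_on_subset)
  qed simp
  then have *: "integrable lborel (\<lambda>t. indicator {0..?h} t *\<^sub>R ?g t)" 
    and **: "iter_diff ((j,l) # P) (F js) x = (\<integral>t. indicator {0..?h} t *\<^sub>R ?g t \<partial>lborel)"
    by (auto simp: has_bochner_integral_iff digit_step_def axis0)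
  have "ennreal (norm (\<integral>t. indicator {0..?h} t *\<^sub>R ?g t \<partial>lborel)) \<le>
    (\<integral>\<^sup>+t. ennreal (norm (indicator {0..?h} t *\<^sub>R ?g t)) \<partial>lborel)"
    by (rule integral_norm_bound_ennreal[OF *])
  also have "\<dots> = (\<integral>\<^sup>+t. indicator {0..?h} t * ennreal \<bar>?g t\<bar> \<partial>lborel)"
    by (intro nn_integral_cong) (auto simp: indicator_def)
  finally show ?thesis using ** by simp
qed

text \<open>Induction on \<open>P\<close>: replace the outer difference by an integral in
  \<open>t\<close>, exchange the two integrals, and translate by \<open>axis j t\<close>. The
  translation moves \<open>S\<close>, so the induction has to run over all \<open>S\<close>; the
  integral in \<open>t\<close> supplies the factor 2^-l.\<close>

lemma iter_diff_bound:
  assumes "S \<in> sets borel"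
    and "\<And>x. x \<in> S \<Longrightarrow> x \<in> cbox 0 One \<and> x + sum_list (map digit_step P) \<in> cbox 0 One"
  shows "(\<integral>\<^sup>+x. indicator S x * ennreal \<bar>iter_diff P (F js) x\<bar> \<partial>lborel) \<le>
    ennreal (\<Prod>p\<leftarrow>P. 1 / 2 ^ snd p) *
      (\<integral>\<^sup>+x. indicator (cbox 0 One) x * ennreal \<bar>F (rev (map fst P) @ js) x\<bar> \<partial>lborel)"
  using assms
proof (induction P arbitrary: S js)
  case Nil
  then show ?case by (auto intro!: nn_integral_mono simp: indicator_def)
next
  case (Cons p P)
  obtain j l where p: "p = (j, l)" by (cases p)
  let ?h = "1/2^l :: real"
  let ?R = "ennreal (\<Prod>p\<leftarrow>P. 1 / 2 ^ snd p) *
      (\<integral>\<^sup>+x. indicator (cbox 0 One) x * ennreal \<bar>F (rev (map fst P) @ j # js) x\<bar> \<partial>lborel)"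
  let ?G = "iter_diff P (F (j # js))"
  have [measurable]: "S \<in> sets borel" by fact
  have [measurable]: "?G \<in> borel_measurable borel"
    by (intro borel_measurable_continuous_onI continuous_iter_diff cont)
  have "continuous_on UNIV (\<lambda>q::(real^'n)\<times>real. fst q + axis j (snd q))"
    by (intro continuous_intros continuous_on_axis)
  then have ax [measurable]: "(\<lambda>q::(real^'n)\<times>real. fst q + axis j (snd q)) \<in> borel_measurable (borel \<Otimes>\<^sub>M borel)"
    unfolding borel_prod by (rule borel_measurable_continuous_onI)
  have "(\<integral>\<^sup>+x. indicator S x * ennreal \<bar>iter_diff (p # P) (F js) x\<bar> \<partial>lborel) \<le>
    (\<integral>\<^sup>+x. \<integral>\<^sup>+t. indicator S x * (indicator {0..?h} t * ennreal \<bar>?G (x + axis j t)\<bar>) \<partial>lborel \<partial>lborel)"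
  proof (rule nn_integral_mono)
    fix x :: "real^'n"
    show "indicator S x * ennreal \<bar>iter_diff (p # P) (F js) x\<bar> \<le> 
      (\<integral>\<^sup>+t. indicator S x * (indicator {0..?h} t * ennreal \<bar>?G (x + axis j t)\<bar>) \<partial>lborel)"
      using Cons.prems(2)[of x] iter_diff_bound_pointwise[of x j l P js]
      unfolding p by (cases "x \<in> S") auto
  qed
  also have "\<dots> = (\<integral>\<^sup>+t. \<integral>\<^sup>+x. indicator S x * (indicator {0..?h} t * ennreal \<bar>?G (x + axis j t)\<bar>) \<partial>lborel \<partial>lborel)"
    by (rule pair_sigma_finite.Fubini'[symmetric, OF pair_sigma_finite.intro]) (auto intro!: lborel.sigma_finite_measure_axioms)
  also have "\<dots> \<le> (\<integral>\<^sup>+t. indicator {0..?h} t * ?R \<partial>lborel)"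
  proof (rule nn_integral_mono)
    fix t :: real
    show "(\<integral>\<^sup>+x. indicator S x * (indicator {0..?h} t * ennreal \<bar>?G (x + axis j t)\<bar>) \<partial>lborel)
      \<le> indicator {0..?h} t * ?R"
    proof (cases "t \<in> {0..?h}")
      case True
      \<comment> \<open>The translated set satisfies the hypothesis for the shorter list, because 0
        \<le> t \<le> 2^-l keeps its points between the old point and the old point moved by the
        full step.\<close>
      let ?S = "{y. y - axis j t \<in> S}"
      have S': "?S \<in> sets borel" by measurable
      have "(\<integral>\<^sup>+x. indicator S x * ennreal \<bar>?G (x + axis j t)\<bar> \<partial>lborel) =
        (\<integral>\<^sup>+x. indicator ?S (axis j t + x) * ennreal \<bar>?G (axis j t + x)\<bar> \<partial>lborel)"
        by (intro nn_integral_cong) (auto simp: indicator_def add.commute)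
      also have "\<dots> = (\<integral>\<^sup>+x. indicator ?S x * ennreal \<bar>?G x\<bar> \<partial>distr lborel borel ((+) (axis j t)))"
        using S' by (subst nn_integral_distr) auto
      also have "\<dots> = (\<integral>\<^sup>+x. indicator ?S x * ennreal \<bar>?G x\<bar> \<partial>lborel)"
        by (subst lborel_distr_plus) simp
      also have "\<dots> \<le> ?R"
      proof (rule Cons.IH[OF S'])
        fix y assume "y \<in> ?S"
        then have y: "y - axis j t \<in> cbox 0 One" "y - axis j t + axis j ?h + sum_list (map digit_step P) \<in> cbox 0 One"
          using Cons.prems(2)[of "y - axis j t"] by (auto simp: p digit_step_def[of "(j, l)"] algebra_simps)
        show "y \<in> cbox 0 One \<and> y + sum_list (map digit_step P) \<in> cbox 0 One"
          unfolding mem_unit_cube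
        proof safe
          fix i
          have a: "0 \<le> y$i - axis j t$i" 
            "y $ i - axis j t $ i + axis j ?h $ i + sum_list (map digit_step P) $ i \<le> 1"
            using y by (auto simp: mem_unit_cube)
          have b: "0 \<le> axis j t $ i" "axis j t $ i \<le> axis j ?h $ i" using True by (auto simp: axis_def)
          note c = a b sum_digit_step_nonneg[of P i]
          show "0 \<le> y $ i" "y $ i \<le> 1" "0 \<le> (y + sum_list (map digit_step P)) $ i"
            "(y + sum_list (map digit_step P)) $ i \<le> 1" using c by auto
        qed
      qed
      finally show ?thesis using True by simp
    qed simp
  qed
  also have "\<dots> = ennreal ?h * ?R"
    by (subst nn_integral_multc) auto
  also have "\<dots> = ennreal (\<Prod>p\<leftarrow>p # P. 1 / 2 ^ snd p) *
      (\<integral>\<^sup>+x. indicator (cbox 0 One) x * ennreal \<bar>F (rev (map fst (p # P)) @ js) x\<bar> \<partial>lborel)"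
  proof -
    have "0 \<le> (\<Prod>p\<leftarrow>P. 1 / 2 ^ snd p :: real)" by (induction P) auto
    then have "ennreal (\<Prod>p\<leftarrow>p # P. 1 / 2 ^ snd p) = ennreal ?h * ennreal (\<Prod>p\<leftarrow>P. 1 / 2 ^ snd p)"
      by (subst ennreal_mult[symmetric]) (auto simp: p)
    then show ?thesis by (simp only: mult.assoc) (simp add: p)
  qed
  finally show ?case .
qed

end

text \<open>Clamping to the cube extends each derivative continuously to the whole space and changes
  nothing on the cube, so derivatives taken within the cube survive. The rest converts
  \<open>upd_coord\<close> at parameter \<open>x $ j\<close> into \<open>axis\<close> at parameter
  0.\<close>

lemma smooth_cube_partial_family:
  fixes f :: "real^'n::finite \<Rightarrow> real"
  assumes "smooth_cube f"
  shows "partial_family (\<lambda>js x. foldr pd js f (clamp 0 One x))"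
proof
  fix js :: "'n list"
  have "continuous_on (cbox 0 One) (foldr pd js f)" using assms by (auto simp: smooth_cube_def)
  then show "continuous_on UNIV (\<lambda>x. foldr pd js f (clamp 0 One x))" by (rule clamp_continuous_on)
next
  fix x :: "real^'n" and js and j
  assume x: "x \<in> cbox 0 One"
  let ?g = "foldr pd js f"
  let ?T = "{t. x + axis j t \<in> cbox 0 One}"
  have "(\<lambda>t. ?g (upd_coord x j t)) differentiable (at (x $ j) within {0..1})"
    using assms x by (auto simp: smooth_cube_def)
  then have "((\<lambda>t. ?g (upd_coord x j t)) has_vector_derivative pd j ?g x) (at (x $ j) within {0..1})"
    unfolding pd_def using vector_derivative_works by blast
  then have "((\<lambda>t. ?g (upd_coord x j t)) has_real_derivative pd j ?g x) (at (x $ j + 0) within (\<lambda>t. x $ j + t) ` ?T)"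
    unfolding has_real_derivative_iff_has_vector_derivative[symmetric]
  proof (simp only: add_0_right, elim DERIV_subset, safe)
    fix t assume "x + axis j t \<in> cbox 0 One"
    then have "0 \<le> (x + axis j t) $ j \<and> (x + axis j t) $ j \<le> 1" unfolding mem_unit_cube by blast
    then show "x $ j + t \<in> {0..1}" by (simp add: axis_def)
  qed
  then have "((\<lambda>t. ?g (upd_coord x j (x $ j + t))) has_real_derivative pd j ?g x * 1) (at 0 within ?T)"
    by (rule DERIV_image_chain[unfolded o_def]) (auto intro!: derivative_eq_intros)
  moreover have "upd_coord x j (x $ j + t) = x + axis j t" for t
    by (simp add: vec_eq_iff upd_coord_def axis_def)
  ultimately have "((\<lambda>t. ?g (x + axis j t)) has_real_derivative pd j ?g x) (at 0 within ?T)"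
    by simp
  then have "((\<lambda>t. ?g (clamp 0 One (x + axis j t))) has_real_derivative pd j ?g x) (at 0 within ?T)"
    unfolding has_field_derivative_def
  proof (rule has_derivative_transform[rotated 2])
    have "axis j 0 = (0 :: real^'n)" by (simp add: vec_eq_iff axis_def)
    then show "0 \<in> ?T" using x by (simp only: mem_Collect_eq add_0_right)
  qed (simp add: clamp_cancel_cbox)
  then show "((\<lambda>t. ?g (clamp 0 One (x + axis j t))) has_real_derivative foldr pd (j # js) f (clamp 0 One x)) (at 0 within ?T)"
    using x by (simp add: clamp_cancel_cbox)
qed

subsection \<open>Dyadic cells\<close>

definition digit_grid :: "nat \<Rightarrow> ('n::finite \<times> nat) set" where
  "digit_grid L = UNIV \<times> {1..L}"

text \<open>The dyadic point whose binary digits equal to 1 sit exactly at the positions in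
  \<open>a\<close>; subsets of \<open>digit_grid L\<close> thus stand for the dyadic grid points of
  level \<open>L\<close>.\<close>

definition corner :: "('n::finite \<times> nat) set \<Rightarrow> real^'n" where
  "corner a = (\<Sum>p\<in>a. digit_step p)"

text \<open>Half-open, so that its translates to the grid points are disjoint.\<close>

definition base_cell :: "nat \<Rightarrow> (real^'n::finite) set" where
  "base_cell L = {y. \<forall>i. 0 \<le> y $ i \<and> y $ i < 1 / 2 ^ L}"

lemma finite_digit_grid [simp]: "finite (digit_grid L)"
  by (simp add: digit_grid_def)

lemma card_digit_grid: "card (digit_grid L :: ('n::finite \<times> nat) set) = CARD('n) * L"
  by (simp add: digit_grid_def card_cartesian_product)

lemma corner_nth:
  assumes "a \<subseteq> digit_grid L"
  shows "corner a $ i = (\<Sum>l=1..L. (if (i, l) \<in> a then 1 / 2 ^ l else 0))"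
proof -
  have "finite a" using assms finite_subset by fastforce
  have "corner a $ i = (\<Sum>p\<in>a. if fst p = i then 1 / 2 ^ snd p else 0)"
    by (auto simp: corner_def digit_step_def axis_def intro!: sum.cong)
  also have "\<dots> = (\<Sum>p\<in>{p\<in>a. fst p = i}. 1 / 2 ^ snd p)"
    using \<open>finite a\<close> by (simp add: sum.If_cases Int_def)
  also have "\<dots> = (\<Sum>l\<in>{l\<in>{1..L}. (i, l) \<in> a}. 1 / 2 ^ l)"
    by (rule sum.reindex_bij_witness[of _ "\<lambda>l. (i, l)" snd]) (use assms in \<open>auto simp: digit_grid_def\<close>)
  also have "\<dots> = (\<Sum>l=1..L. (if (i, l) \<in> a then 1 / 2 ^ l else 0))"
    by (simp add: sum.If_cases Int_def)
  finally show ?thesis .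
qed

text \<open>Here \<open>n\<close> is the integer part of 2^L times the point, and its bit
  \<open>L - l\<close> is the digit at position \<open>l\<close>. So the first \<open>L\<close>
  digits can be recovered from any point of a cell.\<close>

lemma binary_cell_digit:
  fixes b :: "nat \<Rightarrow> bool" and y :: real
  assumes "0 \<le> y" "y < 1 / 2 ^ L"
  obtains n :: nat where
    "real n / 2 ^ L \<le> (\<Sum>l=1..L. (if b l then 1 / 2 ^ l else 0)) + y"
    "(\<Sum>l=1..L. (if b l then 1 / 2 ^ l else 0)) + y < (real n + 1) / 2 ^ L"
    "n < 2 ^ L" "\<And>l. l \<in> {1..L} \<Longrightarrow> odd (n div 2 ^ (L - l)) \<longleftrightarrow> b l"
proof -
  have "\<exists>n::nat. (\<Sum>l=1..L. (if b l then 1 / 2 ^ l else 0)) = real n / 2 ^ L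
    \<and> n < 2 ^ L \<and> (\<forall>l\<in>{1..L}. odd (n div 2 ^ (L - l)) \<longleftrightarrow> b l)"
  proof (induction L)
    case (Suc L)
    then obtain n :: nat where n: "(\<Sum>l=1..L. (if b l then 1 / 2 ^ l else 0)) = real n / 2 ^ L"
      "n < 2 ^ L" "\<And>l. l \<in> {1..L} \<Longrightarrow> odd (n div 2 ^ (L - l)) \<longleftrightarrow> b l" by blast
    \<comment> \<open>Appending the digit at position \<open>Suc L\<close> doubles the integer and
      adds that digit; old bits move up by one place.\<close>
    let ?k = "2 * n + (if b (Suc L) then 1 else 0)"
    have "odd (?k div 2 ^ (Suc L - l)) \<longleftrightarrow> b l" if "l \<in> {1..Suc L}" for l
    proof (cases "l = Suc L")
      case False
      then have "Suc L - l = Suc (L - l)" using that by auto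
      then have "?k div 2 ^ (Suc L - l) = ?k div 2 div 2 ^ (L - l)" by (simp add: div_mult2_eq)
      also have "?k div 2 = n" by auto
      finally show ?thesis using n(3)[of l] that False by auto
    qed auto
    moreover have "(\<Sum>l=1..Suc L. (if b l then 1 / 2 ^ l else 0)) = real ?k / 2 ^ Suc L"
      using n(1) by (simp add: field_simps)
    moreover have "?k < 2 ^ Suc L" using n(2) by auto
    ultimately show ?case by blast
  qed auto
  then obtain n :: nat where n: "(\<Sum>l=1..L. (if b l then 1 / 2 ^ l else 0)) = real n / 2 ^ L"
    "n < 2 ^ L" "\<And>l. l \<in> {1..L} \<Longrightarrow> odd (n div 2 ^ (L - l)) \<longleftrightarrow> b l" by blast
  show ?thesis
  proof (rule that[of n])
    show "(\<Sum>l=1..L. (if b l then 1 / 2 ^ l else 0)) + y < (real n + 1) / 2 ^ L"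
      unfolding n(1) add_divide_distrib using assms by simp
  qed (use n assms in simp_all)
qed

lemma corner_cell_digit:
  assumes "a \<subseteq> digit_grid L" "y \<in> base_cell L"
  obtains n :: nat where
    "real n / 2 ^ L \<le> corner a $ i + y $ i" "corner a $ i + y $ i < (real n + 1) / 2 ^ L"
    "n < 2 ^ L" "\<And>l. l \<in> {1..L} \<Longrightarrow> odd (n div 2 ^ (L - l)) \<longleftrightarrow> (i, l) \<in> a"
proof -
  have y: "0 \<le> y$i" "y$i < 1/2^L" using assms by (auto simp: base_cell_def)
  show thesis
    by (rule binary_cell_digit[OF y, of "\<lambda>l. (i,l) \<in> a"], rule that)
      (simp_all only: corner_nth[OF assms(1)])
qed

text \<open>In each coordinate both digit sets describe the bits of the same integer part.\<close>

lemma corner_inj_cell: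
  assumes "a \<subseteq> digit_grid L" "b \<subseteq> digit_grid L"
    and "y \<in> base_cell L" "z \<in> base_cell L" "corner a + y = corner b + z"
  shows "a = b"
proof -
  have "(i, l) \<in> a \<longleftrightarrow> (i, l) \<in> b" if l: "l \<in> {1..L}" for i l
  proof -
    obtain n where n: "real n / 2 ^ L \<le> corner a $ i + y$i" "corner a $ i + y$i < (real n + 1) / 2 ^ L"
      "odd (n div 2 ^ (L - l)) \<longleftrightarrow> (i, l) \<in> a"
      by (rule corner_cell_digit[OF assms(1,3), of i]) (use l in blast)
    obtain k where k: "real k / 2 ^ L \<le> corner b $ i + z$i" "corner b $ i + z$i < (real k + 1) / 2 ^ L"
      "odd (k div 2 ^ (L - l)) \<longleftrightarrow> (i, l) \<in> b"
      by (rule corner_cell_digit[OF assms(2,4), of i]) (use l in blast)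
    have "corner a $ i + y$i = corner b $ i + z$i" using assms(5) by (metis vector_add_component)
    then have "real n / 2 ^ L < (real k + 1) / 2 ^ L" "real k / 2 ^ L < (real n + 1) / 2 ^ L"
      using n(1,2) k(1,2) by linarith+
    then have "n = k" by (simp add: divide_less_cancel)
    then show ?thesis using n(3) k(3) by simp
  qed
  then show ?thesis using assms(1,2) unfolding digit_grid_def by blast
qed

lemma corner_cell_in_cube:
  assumes "a \<subseteq> digit_grid L" "y \<in> base_cell L"
  shows "corner a + y \<in> cbox 0 One"
  unfolding mem_unit_cube
proof
  fix i
  obtain n where n: "real n / 2 ^ L \<le> corner a $ i + y$i" "corner a $ i + y$i < (real n + 1) / 2 ^ L" "n < 2 ^ L"
    by (rule corner_cell_digit[OF assms, of i])
  have "real (Suc n) \<le> real (2 ^ L)" using n(3) by (subst of_nat_le_iff) simp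
  then have "real n + 1 \<le> 2 ^ L" by simp
  then have "(real n + 1) / 2 ^ L \<le> 1" by simp
  moreover have "0 \<le> real n / 2 ^ L" by simp
  ultimately show "0 \<le> (corner a + y) $ i \<and> (corner a + y) $ i \<le> 1" using n(1,2)
    by (simp only: vector_add_component) linarith
qed

subsection \<open>Walsh coefficients\<close>

definition cell :: "nat \<Rightarrow> ('n::finite \<times> nat) set \<Rightarrow> (real^'n) set" where
  "cell L a = {x. x - corner a \<in> base_cell L}"

text \<open>Integrating over the base cell instead of the shifted one lets an alternating sum over
  corners be taken under a single integral.\<close>

definition cell_integral :: "(real^'n::finite \<Rightarrow> real) \<Rightarrow> nat \<Rightarrow> ('n \<times> nat) set \<Rightarrow> real" where
  "cell_integral g L a = (\<integral>y. indicator (base_cell L) y * g (corner a + y) \<partial>lborel)"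

text \<open>The Walsh coefficient of the index whose binary digit sets are the sections of \<open>A\<close>.\<close>

definition walsh :: "(real^'n::finite \<Rightarrow> real) \<Rightarrow> nat \<Rightarrow> ('n \<times> nat) set \<Rightarrow> real" where
  "walsh g L A = (\<Sum>a\<in>Pow (digit_grid L). (-1) ^ card (a \<inter> A) * cell_integral g L a)"

lemma base_cell_borel [measurable]: "base_cell L \<in> sets borel"
proof -
  have "base_cell L = (\<Inter>i. {y. 0 \<le> y $ i} \<inter> {y. y $ i < 1 / 2 ^ L})"
    by (auto simp: base_cell_def)
  also have "\<dots> \<in> sets borel"
    by (intro sets.countable_INT'' sets.Int borel_closed borel_open closed_Collect_le open_Collect_less
        continuous_intros) auto
  finally show ?thesis .
qed

lemma cell_borel [measurable]: "cell L a \<in> sets borel"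
  unfolding cell_def by measurable

lemma base_cell_subset_cube: "base_cell L \<subseteq> cbox 0 One"
proof
  fix y :: "real^'n" assume "y \<in> base_cell L"
  then have "0 \<le> y $ i \<and> y $ i < 1 / 2 ^ L" for i by (simp add: base_cell_def)
  moreover have "1 / 2 ^ L \<le> (1::real)" by simp
  ultimately show "y \<in> cbox 0 One" unfolding mem_unit_cube by (meson less_eq_real_def order_trans)
qed

lemma emeasure_base_cell:
  "emeasure lborel (base_cell L :: (real^'n::finite) set) = ennreal ((1 / 2 ^ L) ^ CARD('n))"
proof -
  define u :: "real^'n" where "u = (1 / 2 ^ L) *\<^sub>R One"
  have One_nth: "(One :: real^'n) $ i = 1" for i
    using inner_axis[of "One :: real^'n" i 1] inner_sum_left_Basis[of "axis i (1::real) :: real^'n"]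
    by (auto simp: axis_in_Basis_iff)
  then have u_nth: "u $ i = 1 / 2 ^ L" for i
    by (simp only: u_def vector_scaleR_component) simp
  have u_inner: "u \<bullet> b = 1 / 2 ^ L" if "b \<in> Basis" for b using that by (simp add: u_def)
  have vol: "(\<Prod>b\<in>Basis. (u - 0) \<bullet> b) = (1 / 2 ^ L) ^ CARD('n)"
    by (simp add: u_inner)
  have "emeasure lborel (box 0 u) \<le> emeasure lborel (base_cell L :: (real^'n) set)"
    by (intro emeasure_mono) (auto simp: mem_box_cart base_cell_def u_nth less_imp_le)
  moreover have "emeasure lborel (box 0 u) = ennreal ((1 / 2 ^ L) ^ CARD('n))"
    unfolding vol[symmetric] by (intro emeasure_lborel_box) (simp add: u_inner)
  moreover have "emeasure lborel (base_cell L :: (real^'n) set) \<le> emeasure lborel (cbox 0 u)"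
    by (intro emeasure_mono) (auto simp: mem_box_cart base_cell_def u_nth less_imp_le)
  moreover have "emeasure lborel (cbox 0 u) = ennreal ((1 / 2 ^ L) ^ CARD('n))"
    unfolding vol[symmetric] by (intro emeasure_lborel_cbox) (simp add: u_inner)
  ultimately show ?thesis by simp
qed

lemma emeasure_cell:
  "emeasure lborel (cell L a :: (real^'n::finite) set) = ennreal ((1 / 2 ^ L) ^ CARD('n))"
proof -
  have "emeasure lborel (cell L a) = emeasure (distr lborel borel ((+) (corner a))) (cell L a)"
    by (simp add: lborel_distr_plus)
  also have "\<dots> = emeasure lborel (base_cell L :: (real^'n) set)"
    by (subst emeasure_distr) (auto simp: cell_def intro!: arg_cong[where f="emeasure lborel"])
  finally show ?thesis by (simp add: emeasure_base_cell)
qed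

lemma cell_subset_cube: "a \<subseteq> digit_grid L \<Longrightarrow> cell L a \<subseteq> cbox 0 One"
  using corner_cell_in_cube[of a L] by (force simp: cell_def)

lemma disjoint_cells: "disjoint_family_on (cell L) (Pow (digit_grid L))"
  unfolding disjoint_family_on_def
proof (intro ballI impI equals0I)
  fix a b x assume "a \<in> Pow (digit_grid L)" "b \<in> Pow (digit_grid L)" "a \<noteq> b" "x \<in> cell L a \<inter> cell L b"
  then show False using corner_inj_cell[of a L b "x - corner a" "x - corner b"]
    by (auto simp: cell_def)
qed

text \<open>There are 2^(sL) disjoint cells, each of volume 2^-(sL), inside a cube of volume 1, so
  what they leave out is a null set.\<close>

lemma AE_cube_cells:
  "AE x in lborel. (x :: real^'n::finite) \<in> cbox 0 One \<longleftrightarrow> x \<in> (\<Union>a\<in>Pow (digit_grid L). cell L a)"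
proof -
  let ?U = "\<Union>a\<in>Pow (digit_grid L). cell L a :: (real^'n) set"
  have U: "?U \<in> sets borel" by (intro sets.finite_UN) auto
  have "emeasure lborel ?U = (\<Sum>a\<in>Pow (digit_grid L). emeasure lborel (cell L a :: (real^'n) set))"
    by (rule sum_emeasure[symmetric]) (auto intro: disjoint_cells)
  also have "\<dots> = ennreal (2 ^ (CARD('n) * L) * (1 / 2 ^ L) ^ CARD('n))"
    by (simp add: emeasure_cell card_Pow card_digit_grid ennreal_mult ennreal_power[symmetric])
  also have "2 ^ (CARD('n) * L) * (1 / 2 ^ L) ^ CARD('n) = (1::real)"
    by (simp add: power_divide power_mult[symmetric] mult.commute)
  finally have U1: "emeasure lborel ?U = 1" by simp
  have sub: "?U \<subseteq> cbox 0 One" using cell_subset_cube by blast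
  have "emeasure lborel (cbox 0 One - ?U) = emeasure lborel (cbox 0 One :: (real^'n) set) - emeasure lborel ?U"
    using U sub U1 by (intro emeasure_Diff) auto
  also have "\<dots> = 0" by (simp add: U1 emeasure_lborel_cbox_eq)
  finally have "cbox 0 One - ?U \<in> null_sets lborel" using U by (intro null_setsI) auto
  then have "AE x in lborel. x \<notin> cbox 0 One - ?U" by (rule AE_not_in)
  then show ?thesis using sub by (auto elim!: eventually_mono)
qed

lemma integrable_indicator_cube:
  fixes h :: "real^'n::finite \<Rightarrow> real"
  assumes "continuous_on UNIV h" "S \<in> sets borel" "S \<subseteq> cbox 0 One"
  shows "integrable lborel (\<lambda>x. indicator S x * h x)"
proof -
  have "integrable lborel (\<lambda>x. indicator (cbox 0 One) x * h x)"
    using borel_integrable_compact[of "cbox 0 One" h] assms(1) by (auto intro: continuous_on_subset)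
  then have "integrable lborel (\<lambda>x. indicator S x *\<^sub>R (indicator (cbox 0 One) x * h x))"
    using assms by (intro integrable_mult_indicator) auto
  then show ?thesis
    by (rule Bochner_Integration.integrable_cong[THEN iffD1, rotated 2]) (use assms in \<open>auto simp: indicator_def\<close>)
qed

lemma integral_cell:
  fixes g :: "real^'n::finite \<Rightarrow> real"
  assumes "continuous_on UNIV g"
  shows "cell_integral g L a = (\<integral>x. indicator (cell L a) x * g x \<partial>lborel)"
proof -
  have [measurable]: "g \<in> borel_measurable borel" using assms by (rule borel_measurable_continuous_onI)
  have "(\<integral>x. indicator (cell L a) x * g x \<partial>lborel) = (\<integral>x. indicator (cell L a) x * g x \<partial>distr lborel borel ((+) (corner a)))"
    by (simp add: lborel_distr_plus)
  also have "\<dots> = (\<integral>y. indicator (cell L a) (corner a + y) * g (corner a + y) \<partial>lborel)"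
    by (rule integral_distr) auto
  also have "\<dots> = cell_integral g L a" unfolding cell_integral_def
    by (intro Bochner_Integration.integral_cong) (auto simp: cell_def indicator_def)
  finally show ?thesis by simp
qed

lemma walsh_empty:
  fixes g :: "real^'n::finite \<Rightarrow> real"
  assumes "continuous_on UNIV g"
  shows "walsh g L {} = integral (cbox 0 One) g"
proof -
  let ?U = "\<Union>a\<in>Pow (digit_grid L). cell L a :: (real^'n) set"
  have [measurable]: "g \<in> borel_measurable borel" using assms by (rule borel_measurable_continuous_onI)
  have [measurable]: "?U \<in> sets borel" by (intro sets.finite_UN) auto
  have "walsh g L {} = (\<Sum>a\<in>Pow (digit_grid L). (\<integral>x. indicator (cell L a) x * g x \<partial>lborel))"
    by (simp add: walsh_def integral_cell[OF assms])
  also have "\<dots> = (\<integral>x. (\<Sum>a\<in>Pow (digit_grid L). indicator (cell L a) x * g x) \<partial>lborel)"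
    by (intro Bochner_Integration.integral_sum[symmetric] integrable_indicator_cube assms) (auto simp: cell_subset_cube)
  also have "\<dots> = (\<integral>x. indicator ?U x * g x \<partial>lborel)"
    by (intro Bochner_Integration.integral_cong)
      (auto simp: indicator_UN_disjoint[OF _ disjoint_cells] sum_distrib_right)
  also have "\<dots> = (\<integral>x. indicator (cbox 0 One) x * g x \<partial>lborel)"
    using AE_cube_cells[of L, where 'n='n]
    by (intro integral_cong_AE) (auto simp: indicator_def elim!: eventually_mono)
  also have "\<dots> = integral (cbox 0 One) g"
    using integrable_indicator_cube[OF assms, of "cbox 0 One"]
    by (subst set_borel_integral_eq_integral(2)[symmetric])
      (auto simp: set_integrable_def set_lebesgue_integral_def)
  finally show ?thesis .
qed

section \<open>Walsh coefficients as integrals of iterated differences\<close>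

lemma corner_insert: "finite a \<Longrightarrow> p \<notin> a \<Longrightarrow> corner (insert p a) = digit_step p + corner a"
  by (simp add: corner_def)

lemma corner_union: "finite a \<Longrightarrow> finite b \<Longrightarrow> a \<inter> b = {} \<Longrightarrow> corner (a \<union> b) = corner a + corner b"
  by (simp add: corner_def sum.union_disjoint)

lemma corner_set: "distinct P \<Longrightarrow> corner (set P) = sum_list (map digit_step P)"
  by (simp add: corner_def sum_list_distinct_conv_sum_set)

text \<open>Split the subsets according to whether they contain the head \<open>p\<close>. The
  iterated difference carries the sign (-1)^(|P| - |a|), which differs from (-1)^|a| by the global
  factor on the right.\<close>

lemma alternating_sum_corners:
  assumes "distinct P"
  shows "(\<Sum>a\<in>Pow (set P). (-1) ^ card a * g (x + corner a)) = (-1) ^ length P * iter_diff P g x"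
  using assms
proof (induction P arbitrary: x)
  case Nil
  then show ?case by (simp add: corner_def)
next
  case (Cons p P)
  let ?h = "\<lambda>a. (-1) ^ card a * g (x + corner a)"
  have fin: "finite a" if "a \<in> Pow (set P)" for a using that finite_subset by blast
  have "sum ?h (Pow (set (p # P))) = sum ?h (Pow (set P)) + sum ?h (insert p ` Pow (set P))"
    using Cons.prems by (simp add: Pow_insert) (subst sum.union_disjoint, auto)
  also have "sum ?h (insert p ` Pow (set P)) = (\<Sum>a\<in>Pow (set P). ?h (insert p a))"
    using Cons.prems by (intro sum.reindex[unfolded o_def]) (auto simp: inj_on_def)
  also have "\<dots> = (\<Sum>a\<in>Pow (set P). - ((-1) ^ card a * g (x + digit_step p + corner a)))"
  proof (intro sum.cong refl)
    fix a assume a: "a \<in> Pow (set P)"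
    then have "p \<notin> a" using Cons.prems by auto
    then show "?h (insert p a) = - ((-1) ^ card a * g (x + digit_step p + corner a))"
      using fin[OF a] by (simp add: corner_insert add.assoc)
  qed
  also have "\<dots> = - ((-1) ^ length P * iter_diff P g (x + digit_step p))"
    unfolding sum_negf using Cons by simp
  also have "sum ?h (Pow (set P)) = (-1) ^ length P * iter_diff P g x" using Cons by simp
  finally show ?case by (simp add: algebra_simps)
qed

lemma sum_Pow_split:
  assumes "finite G" "A \<subseteq> G"
  shows "(\<Sum>a\<in>Pow G. h a) = (\<Sum>b\<in>Pow (G - A). \<Sum>a\<in>Pow A. h (b \<union> a))"
proof -
  have "(\<Sum>b\<in>Pow (G - A). \<Sum>a\<in>Pow A. h (b \<union> a)) = (\<Sum>(b,a)\<in>Pow (G - A) \<times> Pow A. h (b \<union> a))"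
    by (rule sum.cartesian_product)
  also have "\<dots> = (\<Sum>a\<in>Pow G. h a)"
    by (rule sum.reindex_bij_witness[of _ "\<lambda>a. (a - A, a \<inter> A)" "\<lambda>(b,a). b \<union> a"])
      (use assms in \<open>auto simp: Un_Diff Int_Un_distrib2 Un_Diff_Int intro!: arg_cong[where f=h]\<close>)
  finally show ?thesis by simp
qed

text \<open>The sign in \<open>walsh\<close> sees only \<open>a \<inter> A\<close>. Summing over the
  digits inside \<open>A\<close> builds the iterated difference; the digits outside \<open>A\<close>
  index disjoint cells over which it is integrated, and \<open>iter_diff_bound\<close> applies to
  their union.\<close>

lemma (in partial_family) walsh_bound:
  assumes "distinct P" "set P \<subseteq> digit_grid L"
  shows "\<bar>walsh (F []) L (set P)\<bar> \<le> (\<Prod>p\<leftarrow>P. 1 / 2 ^ snd p) * integral (cbox 0 One) (\<lambda>x. \<bar>F (rev (map fst P)) x\<bar>)"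
proof -
  let ?G = "digit_grid L" and ?A = "set P" and ?g = "F []"
  let ?D = "iter_diff P ?g"
  let ?D' = "\<lambda>x. \<bar>F (rev (map fst P)) x\<bar>"
  have cD: "continuous_on UNIV ?D" by (rule continuous_iter_diff[OF cont])
  have [measurable]: "?D \<in> borel_measurable borel" by (rule borel_measurable_continuous_onI[OF cD])
  have int1: "integrable lborel (\<lambda>y. indicator (base_cell L) y * h (c + y))"
    if "continuous_on UNIV h" for h :: "real^'n \<Rightarrow> real" and c
  proof (rule integrable_indicator_cube)
    show "continuous_on UNIV (\<lambda>y. h (c + y))"
      by (rule continuous_on_compose2[OF that]) (auto intro!: continuous_intros)
  qed (auto simp: base_cell_subset_cube)
  have fin: "finite a" if "a \<subseteq> ?G" for a using that finite_subset finite_digit_grid by blast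
  have "walsh ?g L ?A = (\<Sum>b\<in>Pow (?G - ?A). \<Sum>a\<in>Pow ?A.
      (-1) ^ card ((b \<union> a) \<inter> ?A) * cell_integral ?g L (b \<union> a))"
    unfolding walsh_def by (rule sum_Pow_split) (use assms in auto)
  also have "\<dots> = (\<Sum>b\<in>Pow (?G - ?A). \<Sum>a\<in>Pow ?A.
      (\<integral>y. (-1) ^ card a * (indicator (base_cell L) y * ?g (corner b + corner a + y)) \<partial>lborel))"
  proof (intro sum.cong refl)
    fix a b assume ab: "b \<in> Pow (?G - ?A)" "a \<in> Pow ?A"
    then have "(b \<union> a) \<inter> ?A = a" "b \<inter> a = {}" by auto
    moreover have "finite a" "finite b" using ab fin[of b] finite_subset[of a ?A] by auto
    ultimately show "(-1) ^ card ((b \<union> a) \<inter> ?A) * cell_integral ?g L (b \<union> a) =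
      (\<integral>y. (-1) ^ card a * (indicator (base_cell L) y * ?g (corner b + corner a + y)) \<partial>lborel)"
      by (simp add: cell_integral_def corner_union)
  qed
  also have "\<dots> = (\<Sum>b\<in>Pow (?G - ?A). (\<integral>y. (\<Sum>a\<in>Pow ?A. 
      (-1) ^ card a * (indicator (base_cell L) y * ?g (corner b + corner a + y))) \<partial>lborel))"
    by (intro sum.cong refl Bochner_Integration.integral_sum[symmetric] integrable_mult_right int1 cont)
  also have "\<dots> = (\<Sum>b\<in>Pow (?G - ?A). (\<integral>y. (-1) ^ length P * (indicator (base_cell L) y * ?D (corner b + y)) \<partial>lborel))"
  proof (intro sum.cong refl Bochner_Integration.integral_cong)
    fix b y
    have "(\<Sum>a\<in>Pow ?A. (-1) ^ card a * (indicator (base_cell L) y * ?g (corner b + corner a + y)))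
      = indicator (base_cell L) y * (\<Sum>a\<in>Pow ?A. (-1) ^ card a * ?g (corner b + y + corner a))"
      by (simp add: sum_distrib_left algebra_simps)
    then show "(\<Sum>a\<in>Pow ?A. (-1) ^ card a * (indicator (base_cell L) y * ?g (corner b + corner a + y)))
      = (-1) ^ length P * (indicator (base_cell L) y * ?D (corner b + y))"
      unfolding alternating_sum_corners[OF assms(1)] by simp
  qed
  also have "\<dots> = (-1) ^ length P * (\<Sum>b\<in>Pow (?G - ?A). cell_integral ?D L b)"
    by (simp add: cell_integral_def sum_distrib_left)
  finally have "\<bar>walsh ?g L ?A\<bar> = \<bar>\<Sum>b\<in>Pow (?G - ?A). cell_integral ?D L b\<bar>"
    by (simp add: abs_mult power_abs)
  also have "\<dots> = \<bar>\<Sum>b\<in>Pow (?G - ?A). \<integral>x. indicator (cell L b) x * ?D x \<partial>lborel\<bar>"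
    by (simp add: integral_cell[OF cD])
  finally have w: "\<bar>walsh ?g L ?A\<bar> = \<bar>\<Sum>b\<in>Pow (?G - ?A). \<integral>x. indicator (cell L b) x * ?D x \<partial>lborel\<bar>" .
  let ?S = "\<Union>b\<in>Pow (?G - ?A). cell L b"
  have disj: "disjoint_family_on (cell L) (Pow (?G - ?A))"
    by (rule disjoint_family_on_mono[OF _ disjoint_cells]) auto
  have S: "?S \<in> sets borel" by (intro sets.finite_UN) auto
  have Sc: "?S \<subseteq> cbox 0 One" using cell_subset_cube by blast
  have "(\<Sum>b\<in>Pow (?G - ?A). \<integral>x. indicator (cell L b) x * ?D x \<partial>lborel) =
    (\<integral>x. (\<Sum>b\<in>Pow (?G - ?A). indicator (cell L b) x * ?D x) \<partial>lborel)"
    by (intro Bochner_Integration.integral_sum[symmetric] integrable_indicator_cube cD cell_borel cell_subset_cube) auto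
  also have "\<dots> = (\<integral>x. indicator ?S x * ?D x \<partial>lborel)"
    by (intro Bochner_Integration.integral_cong)
      (auto simp: indicator_UN_disjoint[OF _ disj] sum_distrib_right)
  finally have "ennreal \<bar>walsh ?g L ?A\<bar> = ennreal (norm (\<integral>x. indicator ?S x * ?D x \<partial>lborel))"
    using w by simp
  also have "\<dots> \<le> (\<integral>\<^sup>+x. ennreal (norm (indicator ?S x * ?D x)) \<partial>lborel)"
    by (intro integral_norm_bound_ennreal integrable_indicator_cube cD S Sc)
  also have "\<dots> = (\<integral>\<^sup>+x. indicator ?S x * ennreal \<bar>?D x\<bar> \<partial>lborel)"
    by (intro nn_integral_cong) (auto simp: indicator_def)
  also have "\<dots> \<le> ennreal (\<Prod>p\<leftarrow>P. 1 / 2 ^ snd p) *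
      (\<integral>\<^sup>+x. indicator (cbox 0 One) x * ennreal \<bar>F (rev (map fst P) @ []) x\<bar> \<partial>lborel)"
  proof (rule iter_diff_bound[OF S])
    fix x assume "x \<in> ?S"
    then obtain b where b: "b \<subseteq> ?G - ?A" "x - corner b \<in> base_cell L" by (auto simp: cell_def)
    \<comment> \<open>Turning on all digits of \<open>A\<close> leads from the cell of
      \<open>b\<close> to the cell of \<open>b \<union> A\<close>, which is again inside the
      cube.\<close>
    have "corner (b \<union> ?A) + (x - corner b) \<in> cbox 0 One"
      using b assms by (intro corner_cell_in_cube) auto
    moreover have "corner (b \<union> ?A) = corner b + sum_list (map digit_step P)"
      using b fin[of b] corner_union[of b ?A] corner_set[OF assms(1)] by auto
    ultimately show "x \<in> cbox 0 One \<and> x + sum_list (map digit_step P) \<in> cbox 0 One"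
      using Sc \<open>x \<in> ?S\<close> by (auto simp: algebra_simps)
  qed
  also have "(\<integral>\<^sup>+x. indicator (cbox 0 One) x * ennreal \<bar>F (rev (map fst P) @ []) x\<bar> \<partial>lborel) =
    ennreal (integral (cbox 0 One) ?D')"
  proof -
    have c: "continuous_on UNIV ?D'" by (intro continuous_intros cont)
    note i = integrable_indicator_cube[OF c, of "cbox 0 One"]
    have "(\<integral>\<^sup>+x. indicator (cbox 0 One) x * ennreal \<bar>F (rev (map fst P) @ []) x\<bar> \<partial>lborel) =
      (\<integral>\<^sup>+x. ennreal (indicator (cbox 0 One) x * ?D' x) \<partial>lborel)"
      by (intro nn_integral_cong) (auto simp: indicator_def)
    also have "\<dots> = ennreal (\<integral>x. indicator (cbox 0 One) x * ?D' x \<partial>lborel)"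
      using i by (intro nn_integral_eq_integral) auto
    also have "(\<integral>x. indicator (cbox 0 One) x * ?D' x \<partial>lborel) = integral (cbox 0 One) ?D'"
      using i by (subst set_borel_integral_eq_integral(2)[symmetric])
        (auto simp: set_integrable_def set_lebesgue_integral_def)
    finally show ?thesis .
  qed
  finally have *: "ennreal \<bar>walsh ?g L ?A\<bar> \<le> ennreal (\<Prod>p\<leftarrow>P. 1 / 2 ^ snd p) * ennreal (integral (cbox 0 One) ?D')" .
  have p0: "0 \<le> (\<Prod>p\<leftarrow>P. 1 / 2 ^ snd p :: real)" by (induction P) auto
  have i0: "0 \<le> integral (cbox 0 One) ?D'"
    by (rule integral_nonneg) (auto intro!: integrable_continuous continuous_intros continuous_on_subset[OF cont])
  show ?thesis using * unfolding ennreal_mult[OF p0 i0, symmetric]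
    using p0 i0 by (subst (asm) ennreal_le_iff) auto
qed

subsection \<open>Inversion and the error bound\<close>

definition point_digits :: "nat \<Rightarrow> ('n::finite \<times> nat \<times> nat \<Rightarrow> bool) \<Rightarrow> ('n \<times> nat \<Rightarrow> bool) \<Rightarrow> nat \<Rightarrow> nat \<Rightarrow> ('n \<times> nat) set" where
  "point_digits m C D i L = {p \<in> digit_grid L. pt_digit m C D i (fst p) (snd p)}"

text \<open>The digit vector of \<open>k\<close>, with support \<open>A\<close>, is orthogonal modulo 2 to all columns of the stacked \<open>C_j\<close>.\<close>

definition annihilated :: "nat \<Rightarrow> ('n \<times> nat \<times> nat \<Rightarrow> bool) \<Rightarrow> ('n \<times> nat) set \<Rightarrow> bool" where
  "annihilated m C A \<longleftrightarrow> (\<forall>c<m. even (card {p \<in> A. C (fst p, snd p, c)}))"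

lemma minus_one_power_card:
  assumes "finite A"
  shows "(-1::real) ^ card (X \<inter> A) = (\<Prod>p\<in>A. if p \<in> X then -1 else 1)"
  using assms by (simp add: prod.If_cases Int_commute)

lemma sum_Pow_prod:
  fixes f :: "'a \<Rightarrow> 'b::comm_ring_1"
  assumes "finite G"
  shows "(\<Sum>A\<in>Pow G. \<Prod>p\<in>A. f p) = (\<Prod>p\<in>G. 1 + f p)"
  using prod_add[OF assms, of f "\<lambda>_. 1"] by (simp add: add.commute)

text \<open>The sum over \<open>A\<close> factors over the positions in \<open>G\<close> into
  factors 1 + 1 or 1 - 1, and the latter occurs exactly on the symmetric difference of
  \<open>a\<close> and \<open>b\<close>.\<close>

lemma walsh_orthogonality:
  assumes "finite G" "a \<subseteq> G" "b \<subseteq> G"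
  shows "(\<Sum>A\<in>Pow G. (-1::real) ^ card (a \<inter> A) * (-1) ^ card (b \<inter> A)) = (if a = b then 2 ^ card G else 0)"
proof -
  let ?f = "\<lambda>p. (if p \<in> a then -1 else 1) * (if p \<in> b then -1 else 1) :: real"
  have "(\<Sum>A\<in>Pow G. (-1::real) ^ card (a \<inter> A) * (-1) ^ card (b \<inter> A)) = (\<Sum>A\<in>Pow G. \<Prod>p\<in>A. ?f p)"
    using assms by (intro sum.cong refl) (auto simp: minus_one_power_card finite_subset prod.distrib)
  also have "\<dots> = (\<Prod>p\<in>G. 1 + ?f p)" by (rule sum_Pow_prod[OF assms(1)])
  also have "\<dots> = (if a = b then 2 ^ card G else 0)"
  proof (cases "a = b")
    case True
    then have "(\<Prod>p\<in>G. 1 + ?f p) = (\<Prod>p\<in>G. 2)" by (intro prod.cong) auto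
    then show ?thesis using True by simp
  next
    case False
    then obtain p where "p \<in> G" "(p \<in> a) \<noteq> (p \<in> b)" using assms by blast
    then have "1 + ?f p = 0" by auto
    then have "(\<Prod>p\<in>G. 1 + ?f p) = 0" using \<open>p \<in> G\<close> assms(1) by (intro prod_zero) blast+
    then show ?thesis using False by simp
  qed
  finally show ?thesis .
qed

text \<open>The prefactor is the reciprocal of the volume of a cell, so the left side is the average
  of \<open>g\<close> over the cell.\<close>

lemma walsh_inversion:
  fixes g :: "real^'n::finite \<Rightarrow> real"
  assumes "a \<subseteq> digit_grid L"
  shows "2 ^ (CARD('n) * L) * cell_integral g L a = (\<Sum>A\<in>Pow (digit_grid L). (-1) ^ card (a \<inter> A) * walsh g L A)"
proof -
  let ?G = "digit_grid L :: ('n \<times> nat) set"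
  have "(\<Sum>A\<in>Pow ?G. (-1) ^ card (a \<inter> A) * walsh g L A) =
    (\<Sum>A\<in>Pow ?G. \<Sum>b\<in>Pow ?G. ((-1) ^ card (a \<inter> A) * (-1) ^ card (b \<inter> A)) * cell_integral g L b)"
    by (simp add: walsh_def sum_distrib_left mult.assoc)
  also have "\<dots> = (\<Sum>b\<in>Pow ?G. (\<Sum>A\<in>Pow ?G. (-1) ^ card (a \<inter> A) * (-1) ^ card (b \<inter> A)) * cell_integral g L b)"
    by (subst sum.swap) (simp add: sum_distrib_right)
  also have "\<dots> = (\<Sum>b\<in>Pow ?G. if b = a then 2 ^ card ?G * cell_integral g L a else 0)"
    using assms by (intro sum.cong refl) (auto simp: walsh_orthogonality)
  also have "\<dots> = 2 ^ card ?G * cell_integral g L a" using assms by (simp add: sum.delta)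
  finally show ?thesis by (simp add: card_digit_grid)
qed

text \<open>As \<open>i\<close> runs below 2^m, its bits run through all of {0,1}^m, so the sum of
  products is a product of sums.\<close>

lemma sum_bits_prod:
  fixes g :: "nat \<Rightarrow> bool \<Rightarrow> real"
  shows "(\<Sum>i::nat<2^m. \<Prod>c<m. g c (odd (i div 2 ^ c))) = (\<Prod>c<m. g c False + g c True)"
proof (induction m arbitrary: g)
  case (Suc m)
  \<comment> \<open>Pairing \<open>2 * i\<close> with \<open>2 * i + 1\<close> separates the lowest
    bit.\<close>
  have split: "(\<Sum>i<2*n. h i) = (\<Sum>i<n. h (2*i) + h (2*i+1))" for h :: "nat \<Rightarrow> real" and n
    by (induction n) auto
  have pr: "(\<Prod>c<Suc m. g c (odd (i div 2 ^ c))) = g 0 (odd i) * (\<Prod>c<m. g (Suc c) (odd (i div 2 div 2 ^ c)))" for i :: nat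
    by (subst prod.lessThan_Suc_shift) (simp add: div_mult2_eq)
  have "(\<Sum>i::nat<2^Suc m. \<Prod>c<Suc m. g c (odd (i div 2 ^ c))) =
    (\<Sum>i::nat<2^m. (g 0 False + g 0 True) * (\<Prod>c<m. g (Suc c) (odd (i div 2 ^ c))))"
    unfolding pr power_Suc split by (simp add: algebra_simps)
  also have "\<dots> = (g 0 False + g 0 True) * (\<Prod>c<m. g (Suc c) False + g (Suc c) True)"
    using Suc[of "\<lambda>c. g (Suc c)"] by (simp only: sum_distrib_left[symmetric])
  also have "\<dots> = (\<Prod>c<Suc m. g c False + g c True)"
    by (subst prod.lessThan_Suc_shift) simp
  finally show ?case .
qed simp

text \<open>The sign of a point factors into a part from the shift, constant in \<open>i\<close>,
  and one factor per bit of \<open>i\<close>. Summing over \<open>i\<close> gives a factor 2 for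
  each column orthogonal to \<open>A\<close> and 0 for any other column; the absolute value removes
  the sign of the shift.\<close>

lemma character_sum:
  assumes "A \<subseteq> digit_grid L"
  shows "\<bar>(\<Sum>i<2^m. (-1::real) ^ card (point_digits m C D i L \<inter> A)) / 2 ^ m\<bar> = (if annihilated m C A then 1 else 0)"
proof -
  have fA: "finite A" using assms finite_subset finite_digit_grid by blast
  let ?e = "\<lambda>b. if b then -1 else 1 :: real"
  let ?g = "\<lambda>c x. \<Prod>p\<in>A. ?e (C (fst p, snd p, c) \<and> x)"
  \<comment> \<open>Passing from bits to signs turns addition modulo 2 into multiplication.\<close>
  have dig: "?e (pt_digit m C D i (fst p) (snd p)) = ?e (D p) * (\<Prod>c<m. ?e (C (fst p, snd p, c) \<and> odd (i div 2 ^ c)))" for i p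
  proof -
    let ?X = "{c. c < m \<and> C (fst p, snd p, c) \<and> odd (i div 2 ^ c)}"
    have "(\<Prod>c<m. ?e (C (fst p, snd p, c) \<and> odd (i div 2 ^ c))) = (-1) ^ card ?X"
      by (subst prod.If_cases) (auto intro!: arg_cong[where f="\<lambda>x. (-1) ^ card x"])
    then show ?thesis by (auto simp: pt_digit_def minus_one_power_iff)
  qed
  have "(-1::real) ^ card (point_digits m C D i L \<inter> A) = (\<Prod>p\<in>A. ?e (D p)) * (\<Prod>c<m. ?g c (odd (i div 2 ^ c)))" for i
  proof -
    have "(-1::real) ^ card (point_digits m C D i L \<inter> A) = (\<Prod>p\<in>A. ?e (pt_digit m C D i (fst p) (snd p)))"
      unfolding minus_one_power_card[OF fA] using assms by (intro prod.cong) (auto simp: point_digits_def)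
    also have "\<dots> = (\<Prod>p\<in>A. ?e (D p)) * (\<Prod>p\<in>A. \<Prod>c<m. ?e (C (fst p, snd p, c) \<and> odd (i div 2 ^ c)))"
      unfolding dig by (simp add: prod.distrib)
    finally show ?thesis by (subst (asm) prod.swap)
  qed
  then have "(\<Sum>i<2^m. (-1::real) ^ card (point_digits m C D i L \<inter> A)) =
    (\<Prod>p\<in>A. ?e (D p)) * (\<Prod>c<m. ?g c False + ?g c True)"
    using sum_bits_prod[of ?g m] by (simp only: sum_distrib_left[symmetric])
  also have "(\<Prod>c<m. ?g c False + ?g c True) = (\<Prod>c<m. if even (card {p\<in>A. C (fst p, snd p, c)}) then 2 else 0)"
  proof (intro prod.cong refl)
    fix c
    have "?g c True = (-1) ^ card {p\<in>A. C (fst p, snd p, c)}"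
      using fA by (simp add: prod.If_cases Int_def)
    then show "?g c False + ?g c True = (if even (card {p\<in>A. C (fst p, snd p, c)}) then 2 else 0)"
      by simp
  qed
  also have "\<dots> = (if annihilated m C A then 2 ^ m else 0)"
    by (auto simp: annihilated_def)
  finally have "(\<Sum>i<2^m. (-1::real) ^ card (point_digits m C D i L \<inter> A)) = 
    (\<Prod>p\<in>A. ?e (D p)) * (if annihilated m C A then 2 ^ m else 0)" .
  moreover have "\<bar>\<Prod>p\<in>A. ?e (D p)\<bar> = 1"
    unfolding abs_prod by (intro prod.neutral) auto
  ultimately show ?thesis by (simp add: abs_mult)
qed

text \<open>Insert \<open>walsh_inversion\<close> for every point and exchange the sums: the
  coefficient of \<open>walsh g L A\<close> is the normalised character sum, of modulus 0 or 1, and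
  \<open>A = {}\<close> contributes the integral itself.\<close>

lemma finite_level_error:
  fixes g :: "real^'n::finite \<Rightarrow> real"
  assumes "continuous_on UNIV g"
  shows "\<bar>(\<Sum>i<2^m. 2 ^ (CARD('n) * L) * cell_integral g L (point_digits m C D i L)) / 2 ^ m - integral (cbox 0 One) g\<bar>
    \<le> (\<Sum>A | A \<subseteq> digit_grid L \<and> A \<noteq> {} \<and> annihilated m C A. \<bar>walsh g L A\<bar>)"
proof -
  let ?G = "digit_grid L :: ('n \<times> nat) set"
  let ?c = "\<lambda>A. (\<Sum>i<2^m. (-1::real) ^ card (point_digits m C D i L \<inter> A)) / 2 ^ m"
  have "(\<Sum>i<2^m. 2 ^ (CARD('n) * L) * cell_integral g L (point_digits m C D i L)) =
    (\<Sum>i<2^m. \<Sum>A\<in>Pow ?G. (-1) ^ card (point_digits m C D i L \<inter> A) * walsh g L A)"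
    by (intro sum.cong refl walsh_inversion) (auto simp: point_digits_def)
  then have "(\<Sum>i<2^m. 2 ^ (CARD('n) * L) * cell_integral g L (point_digits m C D i L)) / 2 ^ m =
    (\<Sum>A\<in>Pow ?G. ?c A * walsh g L A)"
    by (subst (asm) sum.swap) (simp add: sum_distrib_right sum_divide_distrib)
  also have "\<dots> = ?c {} * walsh g L {} + (\<Sum>A\<in>Pow ?G - {{}}. ?c A * walsh g L A)"
    by (rule sum.remove) auto
  also have "?c {} * walsh g L {} = integral (cbox 0 One) g" by (simp add: walsh_empty[OF assms])
  finally have "\<bar>(\<Sum>i<2^m. 2 ^ (CARD('n) * L) * cell_integral g L (point_digits m C D i L)) / 2 ^ m - integral (cbox 0 One) g\<bar>
    = \<bar>\<Sum>A\<in>Pow ?G - {{}}. ?c A * walsh g L A\<bar>" by simp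
  also have "\<dots> \<le> (\<Sum>A\<in>Pow ?G - {{}}. \<bar>?c A * walsh g L A\<bar>)" by (rule sum_abs)
  also have "\<dots> = (\<Sum>A\<in>Pow ?G - {{}}. if annihilated m C A then \<bar>walsh g L A\<bar> else 0)"
    by (intro sum.cong refl) (subst abs_mult, subst character_sum, auto)
  also have "\<dots> = (\<Sum>A | A \<subseteq> ?G \<and> A \<noteq> {} \<and> annihilated m C A. \<bar>walsh g L A\<bar>)"
    by (subst sum.inter_filter[symmetric]) (auto intro!: sum.cong)
  finally show ?thesis .
qed

section \<open>From truncated digits to the actual points\<close>

text \<open>Both \<open>y\<close> and the tail of the binary series lie in [0, 2^-L]. A tail of ones
  reaches the right end point, so the design point may fall outside the half-open cell; only
  closeness is claimed.\<close>

lemma corner_point_digits_close: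
  assumes "y \<in> base_cell L"
  shows "\<bar>(corner (point_digits m C D i L) + y) $ j - design_point m C D i $ j\<bar> \<le> 1 / 2 ^ L"
proof -
  let ?b = "\<lambda>l. (if pt_digit m C D i j (Suc l) then 1 else 0) / 2 ^ Suc l :: real"
  have geo: "(\<lambda>l. 1 / 2 ^ Suc l :: real) sums 1" using power_half_series by (simp add: power_one_over)
  have sm: "summable ?b"
    by (rule summable_comparison_test'[OF sums_summable[OF geo], of 0]) (auto simp: divide_simps)
  then have sm': "summable (\<lambda>l. ?b (l + L))" by (rule summable_ignore_initial_segment)
  have tail: "(\<lambda>l. 1 / 2 ^ Suc (l + L) :: real) sums (1 / 2 ^ L)"
    using sums_mult[OF geo, of "1 / 2 ^ L"] by (simp add: power_add mult.commute mult.left_commute)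
  have "corner (point_digits m C D i L) $ j = (\<Sum>l=1..L. if (j, l) \<in> point_digits m C D i L then 1 / 2 ^ l else 0)"
    by (rule corner_nth) (auto simp: point_digits_def)
  also have "\<dots> = (\<Sum>l=1..L. if pt_digit m C D i j l then 1 / 2 ^ l else 0)"
    by (intro sum.cong) (auto simp: point_digits_def digit_grid_def)
  also have "\<dots> = (\<Sum>l<L. ?b l)"
    by (rule sum.reindex_bij_witness[of _ Suc "\<lambda>l. l - 1"]) auto
  finally have "design_point m C D i $ j = corner (point_digits m C D i L) $ j + (\<Sum>l. ?b (l + L))"
    using suminf_split_initial_segment[OF sm, of L] by (simp add: design_point_def)
  moreover have "0 \<le> (\<Sum>l. ?b (l + L))"
    by (intro suminf_nonneg sm') auto
  moreover have "(\<Sum>l. ?b (l + L)) \<le> (\<Sum>l. 1 / 2 ^ Suc (l + L))"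
    using tail by (intro suminf_le sm') (auto simp: sums_iff divide_simps)
  moreover have "(\<Sum>l. 1 / 2 ^ Suc (l + L) :: real) = 1 / 2 ^ L" using tail by (simp add: sums_iff)
  moreover have "0 \<le> y $ j" "y $ j < 1 / 2 ^ L" using assms by (auto simp: base_cell_def)
  ultimately show ?thesis unfolding vector_add_component by linarith
qed

text \<open>By the previous bound the cell shrinks to the design point, where \<open>g\<close> is
  continuous; summing the coordinate distances gives the null sequence s 2^-L.\<close>

lemma cell_average_tendsto:
  fixes g :: "real^'n::finite \<Rightarrow> real"
  assumes "continuous_on UNIV g"
  shows "(\<lambda>L. 2 ^ (CARD('n) * L) * cell_integral g L (point_digits m C D i L)) \<longlonglongrightarrow> g (design_point m C D i)"
proof (rule LIMSEQ_I)
  fix \<epsilon> :: real assume "0 < \<epsilon>"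
  let ?x = "design_point m C D i" and ?a = "point_digits m C D i"
  have "isCont g ?x" using assms by (simp add: continuous_on_eq_continuous_at)
  then obtain \<delta> where d: "\<delta> > 0" "\<And>z. dist z ?x < \<delta> \<Longrightarrow> dist (g z) (g ?x) < \<epsilon> / 2"
    unfolding continuous_at_eps_delta using \<open>0 < \<epsilon>\<close> half_gt_zero by blast
  have "(\<lambda>L. real CARD('n) * (1 / 2) ^ L) \<longlonglongrightarrow> real CARD('n) * 0"
    by (intro tendsto_mult_left LIMSEQ_realpow_zero) auto
  then obtain L0 where L0: "\<And>L. L \<ge> L0 \<Longrightarrow> norm (real CARD('n) * (1 / 2) ^ L - 0) < \<delta>"
    using d(1) LIMSEQ_D by fastforce
  show "\<exists>L0. \<forall>L\<ge>L0. norm (2 ^ (CARD('n) * L) * cell_integral g L (?a L) - g ?x) < \<epsilon>"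
  proof (intro exI allI impI)
    fix L assume L: "L \<ge> L0"
    let ?v = "(1 / 2 ^ L) ^ CARD('n) :: real"
    let ?I = "\<lambda>y::real^'n. indicator (base_cell L) y :: real"
    have close: "\<bar>g (corner (?a L) + y) - g ?x\<bar> \<le> \<epsilon> / 2" if y: "y \<in> base_cell L" for y
    proof -
      have "norm (corner (?a L) + y - ?x) \<le> (\<Sum>j\<in>UNIV. \<bar>(corner (?a L) + y - ?x) $ j\<bar>)" by (rule norm_le_l1_cart)
      also have "\<dots> \<le> (\<Sum>j\<in>(UNIV::'n set). 1 / 2 ^ L)"
        using corner_point_digits_close[OF y, of m C D i] by (intro sum_mono) simp
      also have "\<dots> < \<delta>" using L0[OF L] by (simp add: power_divide)
      finally show ?thesis using d(2)[of "corner (?a L) + y"] by (simp add: dist_norm)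
    qed
    have c': "continuous_on UNIV (\<lambda>y. g (corner (?a L) + y))"
      by (rule continuous_on_compose2[OF assms]) (auto intro!: continuous_intros)
    have i1: "integrable lborel (\<lambda>y. ?I y * g (corner (?a L) + y))"
      by (rule integrable_indicator_cube[OF c']) (auto simp: base_cell_subset_cube)
    have i2: "integrable lborel (\<lambda>y. ?I y * k)" for k :: real
      by (rule integrable_indicator_cube[of "\<lambda>_. k"]) (auto simp: base_cell_subset_cube)
    have meas: "measure lborel (base_cell L :: (real^'n) set) = ?v"
      by (simp add: measure_def emeasure_base_cell)
    have i3: "(\<integral>y. ?I y * k \<partial>lborel) = ?v * k" for k
      using meas by simp
    have "\<bar>cell_integral g L (?a L) - ?v * g ?x\<bar> = \<bar>\<integral>y. ?I y * g (corner (?a L) + y) - ?I y * g ?x \<partial>lborel\<bar>"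
      unfolding cell_integral_def i3[symmetric] by (subst Bochner_Integration.integral_diff[OF i1 i2]) simp
    also have "\<dots> \<le> (\<integral>y. \<bar>?I y * g (corner (?a L) + y) - ?I y * g ?x\<bar> \<partial>lborel)"
      by (rule integral_abs_bound)
    also have "\<dots> \<le> (\<integral>y. ?I y * (\<epsilon> / 2) \<partial>lborel)"
      by (intro integral_mono integrable_abs Bochner_Integration.integrable_diff i1 i2)
        (use close in \<open>auto simp: indicator_def\<close>)
    finally have *: "\<bar>cell_integral g L (?a L) - ?v * g ?x\<bar> \<le> ?v * (\<epsilon> / 2)" by (simp only: i3)
    have v: "2 ^ (CARD('n) * L) * ?v = 1"
      by (simp add: power_divide power_mult[symmetric] mult.commute)
    have "\<bar>2 ^ (CARD('n) * L) * cell_integral g L (?a L) - g ?x\<bar> = \<bar>2 ^ (CARD('n) * L) * (cell_integral g L (?a L) - ?v * g ?x)\<bar>"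
      unfolding right_diff_distrib mult.assoc[symmetric] v by simp
    also have "\<dots> = 2 ^ (CARD('n) * L) * \<bar>cell_integral g L (?a L) - ?v * g ?x\<bar>" by (simp add: abs_mult)
    also have "\<dots> \<le> 2 ^ (CARD('n) * L) * (?v * (\<epsilon> / 2))" using * by (intro mult_left_mono) auto
    also have "\<dots> = \<epsilon> / 2" unfolding mult.assoc[symmetric] v by simp
    finally show "norm (2 ^ (CARD('n) * L) * cell_integral g L (?a L) - g ?x) < \<epsilon>" using \<open>0 < \<epsilon>\<close> by simp
  qed
qed

lemma design_point_in_cube: "design_point m C D i \<in> cbox 0 One"
  unfolding mem_unit_cube
proof
  fix j
  \<comment> \<open>At level 0 the corner is the origin and the distance bound is 1, which yields
    the upper estimate of the coordinate.\<close>
  have "0 \<in> base_cell 0" by (simp add: base_cell_def)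
  then have *: "\<bar>(corner (point_digits m C D i 0) + 0) $ j - design_point m C D i $ j\<bar> \<le> 1 / 2 ^ 0"
    by (rule corner_point_digits_close)
  have "corner (point_digits m C D i 0) = 0" by (simp add: corner_def point_digits_def digit_grid_def)
  moreover have "0 \<le> design_point m C D i $ j"
    unfolding design_point_def vec_lambda_beta
    by (intro suminf_nonneg summable_comparison_test'[OF sums_summable[OF power_half_series], of 0])
       (auto simp: divide_simps)
  ultimately show "0 \<le> design_point m C D i $ j \<and> design_point m C D i $ j \<le> 1" using * by simp
qed

text \<open>The estimate at level \<open>L\<close> passes to the limit because \<open>B\<close> is
  the same for all \<open>L\<close>.\<close>

lemma error_bound:
  fixes f :: "real^'n::finite \<Rightarrow> real"
  assumes "continuous_on (cbox 0 One) f"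
    and "\<And>L. (\<Sum>A | A \<subseteq> digit_grid L \<and> A \<noteq> {} \<and> annihilated m C A. \<bar>walsh (\<lambda>x. f (clamp 0 One x)) L A\<bar>) \<le> B"
  shows "\<bar>mu_hat f m C D - integral (cbox 0 One) f\<bar> \<le> B"
proof -
  let ?g = "\<lambda>x. f (clamp 0 One x)"
  have c: "continuous_on UNIV ?g" using assms(1) by (rule clamp_continuous_on)
  have "(\<lambda>L. \<bar>(\<Sum>i<2^m. 2 ^ (CARD('n) * L) * cell_integral ?g L (point_digits m C D i L)) / 2 ^ m - integral (cbox 0 One) ?g\<bar>)
    \<longlonglongrightarrow> \<bar>(\<Sum>i<2^m. ?g (design_point m C D i)) / 2 ^ m - integral (cbox 0 One) ?g\<bar>"
    by (intro tendsto_intros cell_average_tendsto c) simp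
  then have "\<bar>(\<Sum>i<2^m. ?g (design_point m C D i)) / 2 ^ m - integral (cbox 0 One) ?g\<bar> \<le> B"
    by (rule LIMSEQ_le_const2) (use finite_level_error[OF c] assms(2) order_trans in blast)
  moreover have "integral (cbox 0 One) ?g = integral (cbox 0 One) f"
    by (intro integral_cong) (simp add: clamp_cancel_cbox)
  ultimately show ?thesis
    by (simp add: mu_hat_def clamp_cancel_cbox[OF design_point_in_cube])
qed

subsection \<open>Probability of annihilation\<close>

lemma prob_space_coin: "prob_space coin"
  by (simp add: coin_def measure_pmf.prob_space_axioms)

lemma space_coin [simp]: "space coin = UNIV" and sets_coin [simp]: "sets coin = UNIV"
  by (simp_all add: coin_def)

lemma measure_coin_singleton: "measure coin {b} = 1 / 2"
  by (simp add: coin_def measure_pmf_single)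

definition cylinder :: "'a set \<Rightarrow> 'a set \<Rightarrow> ('a \<Rightarrow> bool) set" where
  "cylinder J B = {C. \<forall>q\<in>J. C q \<longleftrightarrow> q \<in> B}"

lemma cylinder_measure:
  assumes "finite J"
  shows "cylinder J B \<in> sets (PiM UNIV (\<lambda>_. coin))"
    and "measure (PiM UNIV (\<lambda>_. coin)) (cylinder J B) = (1 / 2) ^ card J"
proof -
  interpret product_prob_space "\<lambda>_. coin" "UNIV :: 'a set"
    by (intro product_prob_spaceI prob_space_coin)
  have eq: "cylinder J B = prod_emb UNIV (\<lambda>_. coin) J (Pi\<^sub>E J (\<lambda>q. {q \<in> B}))"
    by (simp add: cylinder_def prod_emb_def space_PiM restrict_PiE_iff vimage_def Pi_def Ball_def)
  show "cylinder J B \<in> sets (PiM UNIV (\<lambda>_. coin))"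
    unfolding eq using assms by (intro sets_PiM_I) auto
  show "measure (PiM UNIV (\<lambda>_. coin)) (cylinder J B) = (1 / 2) ^ card J"
    unfolding eq using assms by (subst measure_PiM_emb) (auto simp: measure_coin_singleton)
qed

definition entries :: "nat \<Rightarrow> ('n \<times> nat) set \<Rightarrow> ('n \<times> nat \<times> nat) set" where
  "entries m A = {(j, l, c). (j, l) \<in> A \<and> c < m}"

lemma entries_image: "entries m A = (\<lambda>(p, c). (fst p, snd p, c)) ` (A \<times> {..<m})"
  by (force simp: entries_def)

lemma finite_entries: "finite A \<Longrightarrow> finite (entries m A)"
  by (simp add: entries_image)

lemma card_entries: "card (entries m A) = card A * m"
  unfolding entries_image by (subst card_image) (auto simp: inj_on_def card_cartesian_product)

text \<open>Annihilation of \<open>A\<close> depends only on the entries in the rows of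
  \<open>A\<close> and the first \<open>m\<close> columns. For finite \<open>A\<close> this gives
  measurability and reduces the probability to counting patterns.\<close>

lemma annihilated_cylinders:
  "{C. annihilated m C A} = (\<Union>B\<in>{B \<in> Pow (entries m A). annihilated m (\<lambda>q. q \<in> B) A}. cylinder (entries m A) B)"
    (is "?L = ?R")
proof -
  have cong: "annihilated m C A \<longleftrightarrow> annihilated m (\<lambda>q. q \<in> B) A" if "C \<in> cylinder (entries m A) B" for C B
  proof -
    have "{p \<in> A. C (fst p, snd p, c)} = {p \<in> A. (fst p, snd p, c) \<in> B}" if "c < m" for c
      using that \<open>C \<in> _\<close> by (force simp: cylinder_def entries_def)
    then show ?thesis by (simp add: annihilated_def)
  qed
  show ?thesis
  proof (intro set_eqI iffI)
    fix C assume C: "C \<in> ?L"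
    let ?B = "{q \<in> entries m A. C q}"
    have in_cyl: "C \<in> cylinder (entries m A) ?B" by (simp add: cylinder_def)
    then have "annihilated m (\<lambda>q. q \<in> ?B) A" using C cong[OF in_cyl] by simp
    then show "C \<in> ?R" by (intro UN_I[where a="?B"] in_cyl) simp
  next
    fix C assume "C \<in> ?R"
    then obtain B where "annihilated m (\<lambda>q. q \<in> B) A" "C \<in> cylinder (entries m A) B"
      by (elim UN_E CollectE conjE)
    then show "C \<in> ?L" using cong[of C B] by simp
  qed
qed

text \<open>In an annihilated pattern one row is determined by the other rows in \<open>A\<close>.\<close>

lemma card_annihilated_patterns:
  assumes "finite A" "A \<noteq> {}"
  shows "card {B \<in> Pow (entries m A). annihilated m (\<lambda>q. q \<in> B) A} * 2 ^ m \<le> 2 ^ card (entries m A)"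
proof -
  obtain p0 where p0: "p0 \<in> A" using assms by blast
  let ?good = "{B \<in> Pow (entries m A). annihilated m (\<lambda>q. q \<in> B) A}"
  let ?E0 = "entries m (A - {p0})"
  have "inj_on (\<lambda>B. B \<inter> ?E0) ?good"
  proof (rule inj_onI)
    fix B B' assume B: "B \<in> ?good" and B': "B' \<in> ?good" and eq: "B \<inter> ?E0 = B' \<inter> ?E0"
    have off: "(fst p, snd p, c) \<in> B \<longleftrightarrow> (fst p, snd p, c) \<in> B'" if "p \<in> A - {p0}" "c < m" for p c
    proof -
      have "(fst p, snd p, c) \<in> ?E0" using that by (simp add: entries_def)
      then show ?thesis using eq by blast
    qed
    have par: "(fst p0, snd p0, c) \<in> X \<longleftrightarrow> odd (card {p \<in> A - {p0}. (fst p, snd p, c) \<in> X})"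
      if "X \<in> ?good" "c < m" for X c
    proof -
      let ?S = "{p \<in> A - {p0}. (fst p, snd p, c) \<in> X}"
      have ev: "even (card {p \<in> A. (fst p, snd p, c) \<in> X})" using that by (simp add: annihilated_def)
      have "finite ?S" "p0 \<notin> ?S" using assms by auto
      moreover have "{p \<in> A. (fst p, snd p, c) \<in> X} = (if (fst p0, snd p0, c) \<in> X then insert p0 ?S else ?S)"
        using p0 by auto
      ultimately show ?thesis using ev by (auto split: if_splits)
    qed
    have "q \<in> B \<longleftrightarrow> q \<in> B'" if q_in: "q \<in> entries m A" for q
    proof -
      obtain p c where q: "q = (fst p, snd p, c)" "p \<in> A" "c < m" 
        using q_in unfolding entries_image by (elim imageE SigmaE) simp
      have "{p \<in> A - {p0}. (fst p, snd p, c) \<in> B} = {p \<in> A - {p0}. (fst p, snd p, c) \<in> B'}"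
        using off q(3) by blast
      then show ?thesis using par[OF B q(3)] par[OF B' q(3)] off q by (cases "p = p0") auto
    qed
    then show "B = B'" using B B' by blast
  qed
  then have "card ?good \<le> card (Pow ?E0)"
    using finite_entries[of "A - {p0}" m] assms by (intro card_inj_on_le) auto
  also have "\<dots> = 2 ^ (card (A - {p0}) * m)"
    using finite_entries[of "A - {p0}" m] assms by (simp add: card_Pow card_entries)
  finally have "card ?good * 2 ^ m \<le> 2 ^ (card (A - {p0}) * m + m)" by (simp add: power_add)
  also have "card (A - {p0}) * m + m = card A * m"
    using card_Suc_Diff1[OF assms(1) p0] by (metis add.commute mult_Suc)
  finally show ?thesis by (simp add: card_entries)
qed

text \<open>Each pattern has probability 2^-(|A| m), and at most a fraction 2^-m of the patterns is
  annihilated.\<close>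

lemma annihilated_measure:
  fixes A :: "('n \<times> nat) set"
  assumes "finite A"
  shows "{C. annihilated m C A} \<in> sets (PiM UNIV (\<lambda>_. coin))"
    and "A \<noteq> {} \<Longrightarrow> measure (PiM UNIV (\<lambda>_. coin)) {C. annihilated m C A} \<le> 1 / 2 ^ m"
proof -
  let ?M = "PiM UNIV (\<lambda>_. coin) :: ('n \<times> nat \<times> nat \<Rightarrow> bool) measure"
  let ?good = "{B \<in> Pow (entries m A). annihilated m (\<lambda>q. q \<in> B) A}"
  interpret product_prob_space "\<lambda>_. coin" "UNIV :: ('n \<times> nat \<times> nat) set"
    by (intro product_prob_spaceI prob_space_coin)
  note fin = finite_entries[OF assms, of m]
  show "{C. annihilated m C A} \<in> sets ?M"
    unfolding annihilated_cylinders using fin by (intro sets.finite_UN cylinder_measure) auto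
  assume "A \<noteq> {}"
  note cg = card_annihilated_patterns[OF assms this, of m]
  have "measure ?M {C. annihilated m C A} \<le> (\<Sum>B\<in>?good. measure ?M (cylinder (entries m A) B))"
    unfolding annihilated_cylinders using fin
    by (intro finite_measure_subadditive_finite) (auto intro: cylinder_measure)
  also have "\<dots> = real (card ?good) / 2 ^ card (entries m A)"
    using fin by (simp add: cylinder_measure power_one_over)
  also have "\<dots> \<le> 1 / 2 ^ m"
  proof -
    have "real (card ?good * 2 ^ m) \<le> real (2 ^ card (entries m A))" using cg of_nat_mono by blast
    then show ?thesis by (simp add: field_simps)
  qed
  finally show "measure ?M {C. annihilated m C A} \<le> 1 / 2 ^ m" .
qed

lemma prob_space_design: "prob_space (design_space :: (('n \<times> nat \<times> nat \<Rightarrow> bool) \<times> ('n \<times> nat \<Rightarrow> bool)) measure)"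
  unfolding design_space_def by (intro prob_space_pair prob_space_PiM prob_space_coin)

lemma annihilated_design:
  fixes A :: "('n \<times> nat) set"
  assumes "finite A"
  shows "{\<omega> \<in> space design_space. annihilated m (fst \<omega>) A} \<in> sets design_space"
    and "A \<noteq> {} \<Longrightarrow> measure design_space {\<omega> \<in> space design_space. annihilated m (fst \<omega>) A} \<le> 1 / 2 ^ m"
proof -
  let ?M = "PiM UNIV (\<lambda>_. coin) :: ('n \<times> nat \<times> nat \<Rightarrow> bool) measure"
  let ?N = "PiM UNIV (\<lambda>_. coin) :: ('n \<times> nat \<Rightarrow> bool) measure"
  interpret M: prob_space ?M by (intro prob_space_PiM prob_space_coin)
  interpret N: prob_space ?N by (intro prob_space_PiM prob_space_coin)
  have eq: "{\<omega> \<in> space design_space. annihilated m (fst \<omega>) A} = {C. annihilated m C A} \<times> space ?N"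
    by (auto simp: design_space_def space_pair_measure space_PiM)
  show "{\<omega> \<in> space design_space. annihilated m (fst \<omega>) A} \<in> sets design_space"
    unfolding eq unfolding design_space_def using annihilated_measure(1)[OF assms] by simp
  have "measure (?M \<Otimes>\<^sub>M ?N) ({C. annihilated m C A} \<times> space ?N) = measure ?M {C. annihilated m C A}"
    using annihilated_measure(1)[OF assms] 
    by (simp add: measure_def N.emeasure_pair_measure_Times N.emeasure_space_1 del: space_PiM)
  then show "A \<noteq> {} \<Longrightarrow> measure design_space {\<omega> \<in> space design_space. annihilated m (fst \<omega>) A} \<le> 1 / 2 ^ m"
    using annihilated_measure(2)[OF assms] unfolding eq unfolding design_space_def by simp
qed

subsection \<open>Counting by weight\<close>

text \<open>This is sinh u \<ge> u: the derivative of the difference is the square of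
  \<open>exp (x / 2) - exp (- x / 2)\<close>.\<close>

lemma exp_minus_exp_neg_ge:
  fixes u :: real
  assumes "0 \<le> u"
  shows "2 * u \<le> exp u - exp (- u)"
proof -
  let ?h = "\<lambda>u::real. exp u - exp (- u) - 2 * u"
  have "?h 0 \<le> ?h u"
  proof (rule DERIV_nonneg_imp_nondecreasing[OF assms], intro exI conjI)
    fix x :: real
    show "(?h has_real_derivative exp x + exp (- x) - 2) (at x)"
      by (auto intro!: derivative_eq_intros)
    have "0 \<le> (exp (x / 2) - exp (- x / 2))\<^sup>2" by simp
    also have "\<dots> = exp x + exp (- x) - 2"
      by (simp add: power2_eq_square algebra_simps mult_exp_exp)
    finally show "0 \<le> exp x + exp (- x) - 2" .
  qed
  then show ?thesis by simp
qed

text \<open>Euler's identity between partitions into distinct and into odd parts, truncated.\<close>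

lemma distinct_parts_le_odd_parts:
  fixes q :: real
  assumes "0 < q" "q < 1"
  shows "(\<Prod>l=1..L. 1 + q ^ l) * (\<Prod>i<L. 1 - q ^ (2 * i + 1)) \<le> 1"
proof -
  let ?Y = "\<lambda>n. \<Prod>l=1..n. 1 - q ^ l"
  have f: "0 < 1 - q ^ l \<and> 1 - q ^ l \<le> 1" if "l \<ge> 1" for l
    using assms that by (simp add: power_less_one_iff)
  have Y: "0 < ?Y n" for n by (intro prod_pos) (use f in auto)
  \<comment> \<open>Further factors lie in (0, 1], so lengthening the product only decreases
    it.\<close>
  have "?Y (L + k) \<le> ?Y L" for k
  proof (induction k)
    case (Suc k)
    have "?Y (L + Suc k) = ?Y (L + k) * (1 - q ^ (L + Suc k))" by simp
    also have "\<dots> \<le> ?Y (L + k) * 1" using f[of "L + Suc k"] less_imp_le[OF Y] by (intro mult_left_mono) auto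
    finally show ?case using Suc by simp
  qed simp
  from this[of L] have "?Y (2 * L) \<le> ?Y L" by (simp add: mult_2)
  moreover have "?Y (2 * L) = (\<Prod>i<L. 1 - q ^ (2 * i + 1)) * (\<Prod>l=1..L. 1 - q ^ (2 * l))"
    by (induction L) (simp_all add: algebra_simps)
  \<comment> \<open>The even exponents factor as (1 + q^l)(1 - q^l); the positive product
    \<open>?Y L\<close> then cancels.\<close>
  moreover have "(\<Prod>l=1..L. 1 - q ^ (2 * l)) = (\<Prod>l=1..L. 1 + q ^ l) * ?Y L"
    unfolding prod.distrib[symmetric]
    by (intro prod.cong refl) (simp only: power_even_eq, simp add: power2_eq_square algebra_simps)
  ultimately have "(\<Prod>l=1..L. 1 + q ^ l) * (\<Prod>i<L. 1 - q ^ (2 * i + 1)) * ?Y L \<le> 1 * ?Y L"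
    by (simp add: algebra_simps)
  then show ?thesis using mult_le_cancel_right_pos[OF Y[of L]] by blast
qed

text \<open>By Euler's inequality the product is at most the reciprocal of the product of 1 -
  q^(2i+1). Its logarithm is expanded in power series; exchanging the sums and using the Basel sum
  gives (1 / (2t)) (pi^2 / 6).\<close>

lemma prod_one_plus_exp_bound:
  fixes t :: real
  assumes "0 < t"
  shows "(\<Prod>l=1..L. 1 + exp (- t * real l)) \<le> exp (pi\<^sup>2 / (12 * t))"
proof -
  define q where "q = exp (- t)"
  have q: "0 < q" "q < 1" using assms by (auto simp: q_def)
  have qp: "q ^ n = exp (- t * real n)" for n
    by (simp add: q_def exp_of_nat_mult[symmetric] mult.commute)
  have odd_lt: "q ^ (2 * i + 1) < 1" for i using power_Suc_less_one[OF q, of "2 * i"] by simp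
  \<comment> \<open>For fixed \<open>n\<close> the sum over \<open>i\<close> is geometric, at most 1
    / (r^-1 - r) with r = q^n, hence at most 1 / (2tn) by the sinh bound. At \<open>n = 0\<close>
    both sides are 0, as division by 0 gives 0, so the series may start there.\<close>
  have term_le: "(\<Sum>i<L. (q ^ (2 * i + 1)) ^ n) / real n \<le> 1 / (2 * t) * (1 / (real n)\<^sup>2)" for n
  proof (cases "n = 0")
    case False
    let ?r = "q ^ n"
    have r: "0 < ?r" "?r < 1" using q False by (auto simp: power_less_one_iff)
    have r2: "?r\<^sup>2 < 1" using r by (simp add: power_less_one_iff)
    have "(\<Sum>i<L. (q ^ (2 * i + 1)) ^ n) = ?r * (\<Sum>i<L. (?r\<^sup>2) ^ i)"
      by (simp add: sum_distrib_left power_mult[symmetric] power_add[symmetric] algebra_simps)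
    also have "(\<Sum>i<L. (?r\<^sup>2) ^ i) = (1 - (?r\<^sup>2) ^ L) / (1 - ?r\<^sup>2)"
      using r2 by (subst sum_gp_strict) auto
    also have "\<dots> \<le> 1 / (1 - ?r\<^sup>2)" using r r2 by (intro divide_right_mono) auto
    finally have "(\<Sum>i<L. (q ^ (2 * i + 1)) ^ n) \<le> ?r * (1 / (1 - ?r\<^sup>2))" using r by simp
    also have "\<dots> = 1 / ((1 - ?r\<^sup>2) / ?r)" by simp
    also have "(1 - ?r\<^sup>2) / ?r = 1 / ?r - ?r" using q by (simp add: field_simps power2_eq_square)
    also have "1 / ?r - ?r = exp (t * real n) - exp (- (t * real n))"
      by (simp add: qp exp_minus field_simps)
    also have "1 / (exp (t * real n) - exp (- (t * real n))) \<le> 1 / (2 * (t * real n))"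
      using exp_minus_exp_neg_ge[of "t * real n"] assms False by (intro divide_left_mono) auto
    finally have "(\<Sum>i<L. (q ^ (2 * i + 1)) ^ n) / real n \<le> 1 / (2 * (t * real n)) / real n"
      by (intro divide_right_mono) auto
    then show ?thesis by (simp add: power2_eq_square mult.assoc)
  qed simp
  have "(\<lambda>n. - (- ((- (- (q ^ (2 * i + 1)))) ^ n) / real n)) sums - ln (1 + - (q ^ (2 * i + 1)))" for i
    using odd_lt[of i] q by (intro sums_minus ln_series') auto
  then have "(\<lambda>n. (q ^ (2 * i + 1)) ^ n / real n) sums - ln (1 - q ^ (2 * i + 1))" for i
    by simp
  then have s1: "(\<lambda>n. (\<Sum>i<L. (q ^ (2 * i + 1)) ^ n / real n)) sums (\<Sum>i<L. - ln (1 - q ^ (2 * i + 1)))"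
    by (intro sums_sum)
  have "(\<lambda>n. 1 / (real (Suc n))\<^sup>2) sums (pi\<^sup>2 / 6)"
    using inverse_squares_sums by (simp add: add.commute)
  then have "(\<lambda>n. 1 / (real n)\<^sup>2) sums (pi\<^sup>2 / 6)"
    by (subst (asm) sums_Suc_iff) simp
  then have s2: "(\<lambda>n. 1 / (2 * t) * (1 / (real n)\<^sup>2)) sums (1 / (2 * t) * (pi\<^sup>2 / 6))"
    by (rule sums_mult)
  have le: "(\<Sum>i<L. - ln (1 - q ^ (2 * i + 1))) \<le> 1 / (2 * t) * (pi\<^sup>2 / 6)"
    by (rule sums_le[OF _ s1 s2]) (use term_le in \<open>simp add: sum_divide_distrib\<close>)
  have pos: "0 < (\<Prod>i<L. 1 - q ^ (2 * i + 1))" using odd_lt by (intro prod_pos) auto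
  have "(\<Prod>l=1..L. 1 + exp (- t * real l)) \<le> 1 / (\<Prod>i<L. 1 - q ^ (2 * i + 1))"
    using distinct_parts_le_odd_parts[OF q, of L] pos by (simp add: qp field_simps)
  also have "\<dots> = exp (\<Sum>i<L. - ln (1 - q ^ (2 * i + 1)))"
    using odd_lt by (simp add: sum_negf exp_minus exp_sum field_simps)
  also have "\<dots> \<le> exp (1 / (2 * t) * (pi\<^sup>2 / 6))" using le by simp
  finally show ?thesis by (simp add: field_simps)
qed

definition weight :: "('n \<times> nat) set \<Rightarrow> nat" where
  "weight A = (\<Sum>p\<in>A. snd p)"

text \<open>The positions in \<open>A\<close> are chosen independently, so the generating function
  factors into s copies of the one-dimensional product.\<close>

lemma sum_exp_weight:
  fixes t :: real
  assumes "0 < t"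
  shows "(\<Sum>A\<in>Pow (digit_grid L :: ('n::finite \<times> nat) set). exp (- t * real (weight A)))
    \<le> exp (real CARD('n) * pi\<^sup>2 / (12 * t))"
proof -
  let ?G = "digit_grid L :: ('n \<times> nat) set"
  have fin: "finite A" if "A \<in> Pow ?G" for A using that finite_subset[OF _ finite_digit_grid] by auto
  have "(\<Sum>A\<in>Pow ?G. exp (- t * real (weight A))) = (\<Sum>A\<in>Pow ?G. \<Prod>p\<in>A. exp (- t * real (snd p)))"
    by (intro sum.cong refl) (simp add: weight_def exp_sum[symmetric] fin sum_distrib_left sum_negf)
  also have "\<dots> = (\<Prod>p\<in>?G. 1 + exp (- t * real (snd p)))" by (rule sum_Pow_prod) simp
  also have "\<dots> = (\<Prod>j\<in>(UNIV :: 'n set). \<Prod>l=1..L. 1 + exp (- t * real l))"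
    unfolding digit_grid_def by (subst prod.cartesian_product) (simp add: case_prod_beta)
  also have "\<dots> = (\<Prod>l=1..L. 1 + exp (- t * real l)) ^ CARD('n)" by simp
  also have "\<dots> \<le> exp (pi\<^sup>2 / (12 * t)) ^ CARD('n)"
    by (intro power_mono prod_one_plus_exp_bound assms prod_nonneg) (auto intro: add_nonneg_nonneg)
  also have "\<dots> = exp (real CARD('n) * pi\<^sup>2 / (12 * t))" by (simp add: exp_of_nat_mult[symmetric])
  finally show ?thesis .
qed

section \<open>Cardinality and factorials measured against the weight\<close>

text \<open>Induction by removing the maximum: it is at least \<open>card S\<close>, while the
  square drops by 2 |S| - 1.\<close>

lemma card_square_le_sum:
  assumes "finite S" "\<And>l. l \<in> S \<Longrightarrow> 1 \<le> l"
  shows "card S ^ 2 \<le> 2 * \<Sum>(S :: nat set)"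
  using assms
proof (induction "card S" arbitrary: S)
  case 0
  then show ?case by simp
next
  case (Suc n)
  then have "S \<noteq> {}" by auto
  let ?S = "S - {Max S}"
  have M: "Max S \<in> S" using \<open>S \<noteq> {}\<close> Suc by simp
  have c: "card ?S = n" using Suc M by simp
  have "card S \<le> card {1..Max S}" using Suc by (intro card_mono) auto
  then have "Suc n \<le> Max S" using Suc by simp
  moreover have "\<Sum>S = Max S + \<Sum>?S" using M Suc by (simp add: sum.remove)
  moreover have "card ?S ^ 2 \<le> 2 * \<Sum>?S" using Suc c by (intro Suc.hyps) auto
  ultimately show ?case using c Suc.hyps(2)[symmetric] by (simp add: power2_eq_square)
qed

text \<open>Apply the preceding lemma to the section of \<open>A\<close> in each coordinate;
  Cauchy-Schwarz over the coordinates costs the factor s.\<close>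

lemma card_square_le_weight:
  assumes "A \<subseteq> (digit_grid L :: ('n::finite \<times> nat) set)"
  shows "real (card A) ^ 2 \<le> 2 * real CARD('n) * real (weight A)"
proof -
  have fA: "finite A" using assms finite_subset finite_digit_grid by blast
  let ?s = "\<lambda>j. {l. (j, l) \<in> A}"
  have sub: "?s j \<subseteq> {1..L}" for j using assms by (auto simp: digit_grid_def)
  then have fs: "finite (?s j)" for j using finite_subset finite_atLeastAtMost by metis
  have A: "A = Sigma UNIV ?s" by auto
  have "card A = (\<Sum>j\<in>UNIV. card (?s j))" by (subst A) (use fs in simp)
  moreover have "weight A = (\<Sum>j\<in>UNIV. \<Sum>(?s j))"
    using sum.Sigma[of UNIV ?s "\<lambda>j l. l"] fs unfolding A[symmetric]
    by (simp add: weight_def case_prod_beta)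
  moreover have "(\<Sum>j\<in>UNIV. real (card (?s j)))\<^sup>2 \<le> (\<Sum>j\<in>UNIV. (real (card (?s j)))\<^sup>2) * real CARD('n)"
    using sum_squared_le_sum_of_squares[of "\<lambda>j. real (card (?s j))" UNIV] by simp
  moreover have "(\<Sum>j\<in>UNIV. (real (card (?s j)))\<^sup>2) \<le> (\<Sum>j\<in>UNIV. 2 * real (\<Sum>(?s j)))"
  proof (rule sum_mono)
    fix j
    have "card (?s j) ^ 2 \<le> 2 * \<Sum>(?s j)" using sub[of j] by (intro card_square_le_sum fs) auto
    then show "(real (card (?s j)))\<^sup>2 \<le> 2 * real (\<Sum>(?s j))"
      by (metis of_nat_le_iff of_nat_mult of_nat_numeral of_nat_power)
  qed
  ultimately have 1: "real (card A) ^ 2 \<le> (\<Sum>j\<in>UNIV. (real (card (?s j)))\<^sup>2) * real CARD('n)"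
    and 2: "(\<Sum>j\<in>UNIV. (real (card (?s j)))\<^sup>2) \<le> 2 * real (weight A)"
    by (simp_all add: sum_distrib_left)
  show ?thesis
    using order_trans[OF 1 mult_right_mono[OF 2, of "real CARD('n)"]] by (simp add: mult_ac)
qed

text \<open>The growth is split into a part of order m ln m free of \<open>A\<close> and a multiple
  of the weight with rate of order (ln m) / m, which the decay 2^-N(A) can absorb.\<close>

lemma power_fact_bound:
  assumes "A \<subseteq> (digit_grid L :: ('n::finite \<times> nat) set)" "0 < \<alpha>" "\<alpha> \<le> a" "1 \<le> a" "m \<ge> 1"
  shows "\<alpha> ^ card A * fact (card A) \<le>
    exp (real m * ln (a * real m) / 2 + (real CARD('n) / real m * (ln (a * real m) + 2)) * real (weight A))"
proof (cases "card A = 0")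
  case True
  have "finite A" using assms(1) finite_subset finite_digit_grid by blast
  then have "A = {}" using True by simp
  moreover have "1 \<le> a * real m" using assms mult_mono[of 1 a 1 "real m"] by simp
  ultimately show ?thesis by (simp add: weight_def)
next
  case False
  let ?r = "real (card A)" and ?m = "real m" and ?s = "real CARD('n)" and ?w = "real (weight A)"
  let ?l = "ln (a * ?m)"
  have am: "1 \<le> a * ?m" using assms mult_mono[of 1 a 1 ?m] by simp
  have r2: "?r\<^sup>2 \<le> 2 * ?s * ?w" by (rule card_square_le_weight[OF assms(1)])
  have m0: "0 < ?m" using assms by simp
  have "\<alpha> ^ card A * fact (card A) \<le> a ^ card A * ?r ^ card A"
    using assms fact_le_power[of "card A", where 'a=real] by (intro mult_mono power_mono) auto
  \<comment> \<open>The scale \<open>m\<close> fits the threshold: weights of order m^2 allow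
    cardinalities of order m, where \<open>card A / m\<close> stays bounded.\<close>
  also have "\<dots> = (a * ?m) ^ card A * (?r / ?m) ^ card A"
    using m0 by (simp add: power_mult_distrib[symmetric])
  also have "\<dots> \<le> exp (?r * ?l) * exp (?r\<^sup>2 / ?m)"
  proof (intro mult_mono)
    show "(a * ?m) ^ card A \<le> exp (?r * ?l)" using am by (simp add: exp_of_nat_mult)
    have "?r / ?m \<le> exp (?r / ?m)" using exp_ge_add_one_self[of "?r / ?m"] by linarith
    then have "(?r / ?m) ^ card A \<le> exp (?r / ?m) ^ card A" using m0 by (intro power_mono) auto
    also have "\<dots> = exp (?r\<^sup>2 / ?m)" by (simp add: exp_of_nat_mult[symmetric] power2_eq_square)
    finally show "(?r / ?m) ^ card A \<le> exp (?r\<^sup>2 / ?m)" .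
  qed (use am m0 in auto)
  also have "\<dots> = exp (?r * ?l + ?r\<^sup>2 / ?m)" by (simp add: exp_add)
  also have "\<dots> \<le> exp (?m * ?l / 2 + (?s / ?m * (?l + 2)) * ?w)"
  proof -
    have l0: "0 \<le> ?l" using am by simp
    \<comment> \<open>The inequality between arithmetic and geometric means trades the linear term
      in \<open>card A\<close> for m / 2 plus a quadratic term, which the weight controls.\<close>
    have "2 * ?r * ?m \<le> ?m\<^sup>2 + ?r\<^sup>2" using sum_squares_bound[of ?r ?m] by simp
    then have "?r \<le> (?m\<^sup>2 + ?r\<^sup>2) / (2 * ?m)" using m0 by (simp add: field_simps)
    also have "\<dots> = ?m / 2 + ?r\<^sup>2 / (2 * ?m)" using m0 by (simp add: field_simps power2_eq_square)
    also have "\<dots> \<le> ?m / 2 + (2 * ?s * ?w) / (2 * ?m)" using r2 m0 by (intro add_left_mono divide_right_mono) auto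
    finally have "?r \<le> ?m / 2 + ?s * ?w / ?m" by simp
    then have 1: "?r * ?l \<le> (?m / 2 + ?s * ?w / ?m) * ?l" using l0 by (rule mult_right_mono)
    have 2: "?r\<^sup>2 / ?m \<le> 2 * ?s * ?w / ?m" using r2 m0 by (intro divide_right_mono) auto
    have "?r * ?l + ?r\<^sup>2 / ?m \<le> (?m / 2 + ?s * ?w / ?m) * ?l + 2 * ?s * ?w / ?m" using 1 2 by linarith
    also have "\<dots> = ?m * ?l / 2 + (?s / ?m * (?l + 2)) * ?w" by (simp add: algebra_simps add_divide_distrib)
    finally show ?thesis by simp
  qed
  finally show ?thesis .
qed

subsection \<open>Size of the coefficients and of the tail\<close>

text \<open>Matches a word of coordinates, as used in \<open>partial_family\<close>, with the nested
  powers in \<open>mixed_deriv\<close>.\<close>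

lemma foldr_pd_replicates:
  "foldr pd (concat (map (\<lambda>j. replicate (r j) j) js)) f = foldr (\<lambda>j h. (pd j ^^ r j) h) js f"
proof (induction js)
  case (Cons j js)
  have "foldr pd (replicate k j) h = (pd j ^^ k) h" for k h by (induction k) simp_all
  then show ?case using Cons by simp
qed simp

text \<open>Shows that every derivative order \<open>r\<close> is realised by some \<open>k\<close>,
  so the hypothesis on \<open>f\<close> covers all orders.\<close>

lemma card_digit_set_mask: "card (digit_set (2 ^ r - 1)) = r"
proof -
  have "bit (mask r :: nat) n \<longleftrightarrow> n < r" for n by (simp add: bit_mask_iff)
  then have h: "odd ((2 ^ r - 1 :: nat) div 2 ^ n) \<longleftrightarrow> n < r" for n
    unfolding bit_iff_odd mask_eq_exp_minus_1 .
  have "digit_set (2 ^ r - 1) = {1..r}" unfolding digit_set_def h by auto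
  then show ?thesis by simp
qed

lemma prod_fact_le_fact_sum:
  assumes "finite S"
  shows "(\<Prod>j\<in>S. fact (r j)) \<le> (fact (\<Sum>j\<in>S. r j) :: real)"
  using assms
proof (induction S)
  case (insert j S)
  have "real (fact (r j) * fact (sum r S)) \<le> real (fact (r j + sum r S))"
    by (intro of_nat_mono dvd_imp_le fact_fact_dvd_fact) simp
  then have "fact (r j) * fact (sum r S) \<le> (fact (r j + sum r S) :: real)" by simp
  moreover have "fact (r j) * (\<Prod>j\<in>S. fact (r j)) \<le> fact (r j) * (fact (sum r S) :: real)"
    using insert by (intro mult_left_mono) auto
  ultimately have "fact (r j) * (\<Prod>j\<in>S. fact (r j)) \<le> (fact (r j + sum r S) :: real)" by (rule order_trans[rotated])
  then show ?case using insert by simp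
qed simp

lemma distinct_concat_pairs:
  assumes "distinct js" "\<And>j. distinct (xs j)"
  shows "distinct (concat (map (\<lambda>j. map (Pair j) (xs j)) js))"
  using assms by (induction js) (auto simp: distinct_map inj_on_def)

text \<open>Enumerate \<open>A\<close> so that the derivative in \<open>walsh_bound\<close> is the
  mixed derivative of the hypothesis, and bound every product of factorials by the single factorial
  of |A|.\<close>

lemma walsh_coefficient_bound:
  fixes f :: "real^'n::{finite,linorder} \<Rightarrow> real"
  assumes f: "smooth_cube f" and K: "K > 0" and \<alpha>: "\<alpha> > 0" and J: "\<J> \<noteq> {}"
    and bound: "\<And>k :: 'n \<Rightarrow> nat.
        integral (cbox 0 One) (\<lambda>x. \<bar>mixed_deriv (\<lambda>j. card (digit_set (k j))) f x\<bar>)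
          \<le> K * \<alpha> ^ (\<Sum>j\<in>UNIV. card (digit_set (k j)))
               * Max ((\<lambda>J. \<Prod>j\<in>J. fact (card (digit_set (k j)))) ` \<J>)"
    and A: "A \<subseteq> digit_grid L"
  shows "\<bar>walsh (\<lambda>x. f (clamp 0 One x)) L A\<bar> \<le> K * (1 / 2) ^ weight A * (\<alpha> ^ card A * fact (card A))"
proof -
  let ?s = "\<lambda>j. {l. (j, l) \<in> A}" and ?js = "sorted_list_of_set (UNIV :: 'n set)"
  let ?F = "\<lambda>js x. foldr pd js f (clamp 0 One x)"
  interpret partial_family ?F by (rule smooth_cube_partial_family[OF f])
  have "?s j \<subseteq> {1..L}" for j using A by (auto simp: digit_grid_def)
  then have fs: "finite (?s j)" for j using finite_subset finite_atLeastAtMost by metis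
  \<comment> \<open>Coordinates appear in the order of \<open>mixed_deriv\<close>. Since
    \<open>walsh_bound\<close> reverses its list, it will be applied to
    \<open>rev Q\<close>.\<close>
  define Q where "Q = concat (map (\<lambda>j. map (Pair j) (sorted_list_of_set (?s j))) ?js)"
  have setQ: "set Q = A" using fs by (auto simp: Q_def)
  have distQ: "distinct Q"
    unfolding Q_def by (intro distinct_concat_pairs) simp_all
  have fstQ: "map fst Q = concat (map (\<lambda>j. replicate (card (?s j)) j) ?js)"
    unfolding Q_def map_concat using fs by (simp add: comp_def map_replicate_const)
  have mixed: "foldr pd (map fst Q) f = mixed_deriv (\<lambda>j. card (?s j)) f"
    unfolding fstQ foldr_pd_replicates mixed_deriv_def ..
  have "(\<Prod>p\<leftarrow>rev Q. 1 / 2 ^ snd p :: real) = (\<Prod>p\<in>A. 1 / 2 ^ snd p)"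
    using prod.distinct_set_conv_list[of "rev Q" "\<lambda>p. 1 / 2 ^ snd p :: real"] distQ setQ by simp
  also have "\<dots> = (1 / 2) ^ weight A"
    by (simp add: weight_def power_sum power_one_over)
  finally have prod: "(\<Prod>p\<leftarrow>rev Q. 1 / 2 ^ snd p :: real) = (1 / 2) ^ weight A" .
  have cardA: "card A = (\<Sum>j\<in>UNIV. card (?s j))"
  proof -
    have "Sigma UNIV ?s = A" by auto
    then show ?thesis using card_SigmaI[of UNIV ?s] fs by simp
  qed
  have "\<bar>walsh (?F []) L (set (rev Q))\<bar> \<le> (\<Prod>p\<leftarrow>rev Q. 1 / 2 ^ snd p) *
      integral (cbox 0 One) (\<lambda>x. \<bar>?F (rev (map fst (rev Q))) x\<bar>)"
    using distQ setQ A by (intro walsh_bound) auto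
  also have "integral (cbox 0 One) (\<lambda>x. \<bar>?F (rev (map fst (rev Q))) x\<bar>) =
      integral (cbox 0 One) (\<lambda>x. \<bar>mixed_deriv (\<lambda>j. card (?s j)) f x\<bar>)"
    by (intro integral_cong) (simp add: rev_map mixed clamp_cancel_cbox)
  also have "\<dots> \<le> K * (\<alpha> ^ card A * fact (card A))"
  proof -
    have "integral (cbox 0 One) (\<lambda>x. \<bar>mixed_deriv (\<lambda>j. card (?s j)) f x\<bar>) \<le>
      K * \<alpha> ^ card A * Max ((\<lambda>J. \<Prod>j\<in>J. fact (card (?s j))) ` \<J>)"
      using bound[of "\<lambda>j. 2 ^ card (?s j) - 1"] unfolding card_digit_set_mask cardA .
    also have "\<dots> \<le> K * \<alpha> ^ card A * fact (card A)"
    proof (intro mult_left_mono)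
      have fin: "finite \<J>" by simp
      have "(\<Prod>j\<in>J. fact (card (?s j))) \<le> (fact (card A) :: real)" for J :: "'n set"
      proof -
        have "(\<Prod>j\<in>J. fact (card (?s j))) \<le> (fact (\<Sum>j\<in>J. card (?s j)) :: real)"
          by (rule prod_fact_le_fact_sum) simp
        also have "\<dots> \<le> fact (card A)" unfolding cardA by (intro fact_mono sum_mono2) auto
        finally show ?thesis .
      qed
      then show "Max ((\<lambda>J. \<Prod>j\<in>J. fact (card (?s j))) ` \<J>) \<le> (fact (card A) :: real)"
        using fin J by (subst Max_le_iff) auto
    qed (use K \<alpha> in auto)
    finally show ?thesis by simp
  qed
  finally show ?thesis unfolding prod using setQ by (simp add: mult_ac)
qed

section \<open>Annihilated sets of low and of high weight\<close>

text \<open>Union bound over the sets of weight at most \<open>T\<close>, whose number is estimated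
  by exponential weighting with the free parameter \<open>t\<close>.\<close>

lemma low_weight_annihilated_prob:
  fixes T t :: real and m :: nat
  assumes "0 < t"
  defines "E \<equiv> {\<omega> \<in> space design_space. \<exists>L. \<exists>A \<subseteq> (digit_grid L :: ('n::finite \<times> nat) set).
      A \<noteq> {} \<and> real (weight A) \<le> T \<and> annihilated m (fst \<omega>) A}"
  shows "E \<in> sets design_space"
    and "measure design_space E \<le> exp (t * T + real CARD('n) * pi\<^sup>2 / (12 * t)) / 2 ^ m"
proof -
  let ?M = "nat \<lfloor>T\<rfloor>"
  let ?G = "digit_grid ?M :: ('n \<times> nat) set"
  let ?Q = "{A \<in> Pow ?G. A \<noteq> {} \<and> real (weight A) \<le> T}"
  let ?Z = "\<lambda>A. {\<omega> \<in> space design_space. annihilated m (fst \<omega>) A}"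
  interpret prob_space "design_space :: (('n \<times> nat \<times> nat \<Rightarrow> bool) \<times> ('n \<times> nat \<Rightarrow> bool)) measure"
    by (rule prob_space_design)
  \<comment> \<open>No position exceeds the weight, so one grid serves all \<open>L\<close> and the
    event is a finite union.\<close>
  have low: "A \<subseteq> ?G" if "A \<subseteq> digit_grid L" "real (weight A) \<le> T" for L and A :: "('n \<times> nat) set"
  proof
    fix p assume p: "p \<in> A"
    have "finite A" using that finite_subset finite_digit_grid by blast
    then have "snd p \<le> weight A" unfolding weight_def using p by (intro member_le_sum) auto
    then have "snd p \<le> ?M" using that(2) by linarith
    then show "p \<in> ?G" using p that(1) by (auto simp: digit_grid_def)
  qed
  have E: "E = (\<Union>A\<in>?Q. ?Z A)" unfolding E_def using low by blast
  have fin: "finite ?Q" by simp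
  have finA: "finite A" if "A \<in> ?Q" for A using that finite_subset[OF _ finite_digit_grid] by auto
  show sets: "E \<in> sets design_space"
    unfolding E using fin finA by (intro sets.finite_UN annihilated_design(1)) auto
  have "measure design_space E \<le> (\<Sum>A\<in>?Q. measure design_space (?Z A))"
    unfolding E using fin finA by (intro finite_measure_subadditive_finite) (auto intro: annihilated_design(1))
  also have "\<dots> \<le> (\<Sum>A\<in>?Q. 1 / 2 ^ m)"
    using finA by (intro sum_mono annihilated_design(2)) auto
  \<comment> \<open>Each counted set has \<open>exp (t * (T - weight A))\<close> at least 1;
    afterwards the sum may run over all subsets of the grid.\<close>
  also have "\<dots> \<le> (\<Sum>A\<in>?Q. exp (t * T) * exp (- t * real (weight A)) / 2 ^ m)"
  proof (intro sum_mono divide_right_mono)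
    fix A assume "A \<in> ?Q"
    then have "0 \<le> t * (T - real (weight A))" using assms by simp
    then show "1 \<le> exp (t * T) * exp (- t * real (weight A))"
      unfolding exp_add[symmetric] by (simp add: algebra_simps)
  qed simp
  also have "\<dots> \<le> (\<Sum>A\<in>Pow ?G. exp (t * T) * exp (- t * real (weight A)) / 2 ^ m)"
    by (intro sum_mono2) auto
  also have "\<dots> = exp (t * T) * (\<Sum>A\<in>Pow ?G. exp (- t * real (weight A))) / 2 ^ m"
    by (simp add: sum_distrib_left sum_divide_distrib)
  also have "\<dots> \<le> exp (t * T) * exp (real CARD('n) * pi\<^sup>2 / (12 * t)) / 2 ^ m"
    by (intro divide_right_mono mult_left_mono sum_exp_weight assms) auto
  finally show "measure design_space E \<le> exp (t * T + real CARD('n) * pi\<^sup>2 / (12 * t)) / 2 ^ m"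
    by (simp add: exp_add)
qed

text \<open>Reserve exp(-t N(A)) for Euler's bound. The remaining exponential has rate -(ln 2 -
  \<delta> - t), which is not positive, and is therefore largest at the threshold
  \<open>T\<close>.\<close>

lemma high_weight_tail:
  fixes u \<delta> t T K :: real
  assumes "K > 0" "0 < t" "t + \<delta> \<le> ln 2" "finite S" "S \<subseteq> Pow (digit_grid L :: ('n::finite \<times> nat) set)"
    and "\<And>A. A \<in> S \<Longrightarrow> T \<le> real (weight A)"
    and "\<And>A. A \<in> S \<Longrightarrow> v A \<le> K * (1 / 2) ^ weight A * exp (u + \<delta> * real (weight A))"
  shows "sum v S \<le> K * exp (u - (ln 2 - \<delta> - t) * T + real CARD('n) * pi\<^sup>2 / (12 * t))"
proof -
  let ?c = "K * exp (u - (ln 2 - \<delta> - t) * T)"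
  have "sum v S \<le> (\<Sum>A\<in>S. ?c * exp (- t * real (weight A)))"
  proof (rule sum_mono)
    fix A assume A: "A \<in> S"
    have "(1 / 2) ^ weight A = exp (- ln 2 * real (weight A))"
      by (simp add: exp_minus exp_of_nat2_mult power_one_over inverse_eq_divide)
    then have "v A \<le> K * exp (- ln 2 * real (weight A) + (u + \<delta> * real (weight A)))"
      using assms(7)[OF A] by (simp only: exp_add mult.assoc)
    also have "\<dots> \<le> K * exp (u - (ln 2 - \<delta> - t) * T + - t * real (weight A))"
    proof -
      have "(ln 2 - \<delta> - t) * T \<le> (ln 2 - \<delta> - t) * real (weight A)"
        using assms(3) assms(6)[OF A] by (intro mult_left_mono) auto
      then show ?thesis using assms(1) by (simp add: algebra_simps)
    qed
    finally show "v A \<le> ?c * exp (- t * real (weight A))" unfolding exp_add by simp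
  qed
  also have "\<dots> \<le> (\<Sum>A\<in>Pow (digit_grid L :: ('n \<times> nat) set). ?c * exp (- t * real (weight A)))"
    using assms by (intro sum_mono2) auto
  also have "\<dots> \<le> ?c * exp (real CARD('n) * pi\<^sup>2 / (12 * t))"
    unfolding sum_distrib_left[symmetric] using assms(1) by (intro mult_left_mono sum_exp_weight assms) auto
  finally show ?thesis by (simp add: exp_add)
qed

section \<open>Choice of the parameters and the resulting exponents\<close>

text \<open>With T0 = \<lambda> x^2 / s, this \<open>t\<close> minimises t T0 + s pi^2 / (12 t):
  both terms equal half of x ln 2, so together they match 2^x exactly. The third identity fixes the
  constant by which the threshold must be lowered to gain \<gamma> ln x.\<close>

lemma exponent_identities:
  fixes x s \<gamma> :: real
  assumes "0 < x" "0 < s"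
  defines "t \<equiv> s * pi\<^sup>2 / (6 * x * ln 2)"
  shows "t * (lam_const * x\<^sup>2 / s) = x * ln 2 / 2"
    and "s * pi\<^sup>2 / (12 * t) = x * ln 2 / 2"
    and "t * (6 * \<gamma> * ln 2 / (s * pi\<^sup>2) * x * ln x) = \<gamma> * ln x"
proof -
  have l2: "ln 2 \<noteq> (0::real)" by simp
  show "t * (lam_const * x\<^sup>2 / s) = x * ln 2 / 2" "s * pi\<^sup>2 / (12 * t) = x * ln 2 / 2"
    "t * (6 * \<gamma> * ln 2 / (s * pi\<^sup>2) * x * ln x) = \<gamma> * ln x"
    using assms(1,2) l2 by (simp_all add: t_def lam_const_def field_simps power2_eq_square)
qed

text \<open>The leading term is -ln 2 times \<lambda> x^2 / s; everything else is O(x ln x). The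
  summands of \<Gamma> come, in order, from the constant part of \<open>power_fact_bound\<close>,
  from the lowered threshold, from \<delta> times the leading part of \<open>T\<close>, and from the
  two halves of x ln 2. The bound 1 \<le> ln x absorbs the constants.\<close>

lemma tail_exponent_bound:
  fixes x s a c t :: real
  assumes "1 \<le> ln x" "0 < x" "0 < s" "1 \<le> a" "0 \<le> c"
  defines "\<delta> \<equiv> s / x * (ln (a * x) + 2)" and "t \<equiv> s * pi\<^sup>2 / (6 * x * ln 2)"
    and "T \<equiv> lam_const * x\<^sup>2 / s - c * x * ln x"
    and "\<Gamma> \<equiv> (ln a + 1) / 2 + ln 2 * c + lam_const * (ln a + 3) + ln 2"
  shows "exp (x * ln (a * x) / 2 - (ln 2 - \<delta> - t) * T + s * pi\<^sup>2 / (12 * t))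
    \<le> 2 powr (- lam_const * x\<^sup>2 / s + \<Gamma> * x * log 2 x)"
proof -
  let ?l = "ln x"
  define X where "X = lam_const * x\<^sup>2 / s"
  have TX: "T = X - c * x * ?l" by (simp add: T_def X_def)
  have lam: "0 \<le> lam_const" by (simp add: lam_const_def)
  have la: "0 \<le> ln a" using assms(1-5) by simp
  have lax: "ln (a * x) = ln a + ?l" using assms(1-5) by (simp add: ln_mult)
  have "0 \<le> ln a + ?l + 2" using assms(1) la by linarith
  then have \<delta>0: "0 \<le> \<delta>" using assms(2,3) unfolding \<delta>_def lax by simp
  have t0: "0 \<le> t" using assms(1-5) by (simp add: t_def)
  note id = exponent_identities[OF assms(2,3), folded t_def X_def]
  have \<delta>X: "\<delta> * X = lam_const * x * (ln a + ?l + 2)"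
    using assms(1-5) unfolding \<delta>_def lax X_def by (simp add: field_simps power2_eq_square)
  \<comment> \<open>This product enters the exponent with a minus sign and is dropped.\<close>
  have "0 \<le> (\<delta> + t) * (c * x * ?l)" 
    using order_trans[OF zero_le_one assms(1)]
    by (intro mult_nonneg_nonneg add_nonneg_nonneg \<delta>0 t0 assms(5) less_imp_le[OF assms(2)])
  then have "x * ln (a * x) / 2 - (ln 2 - \<delta> - t) * T + s * pi\<^sup>2 / (12 * t) \<le>
    x * (ln a + ?l) / 2 - ln 2 * X + ln 2 * (c * x * ?l) + \<delta> * X + t * X + s * pi\<^sup>2 / (12 * t)"
    unfolding TX lax by (simp add: algebra_simps)
  also have "\<dots> = - ln 2 * X + x * ((ln a + ?l) / 2 + ln 2 * c * ?l + lam_const * (ln a + ?l + 2) + ln 2)"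
    unfolding \<delta>X id by (simp add: algebra_simps add_divide_distrib)
  also have "\<dots> \<le> - ln 2 * X + x * (\<Gamma> * ?l)"
  proof -
    have al: "ln a \<le> ln a * ?l" using mult_left_mono[OF assms(1) la] by simp
    have 1: "(ln a + ?l) / 2 \<le> (ln a + 1) / 2 * ?l" using al by (simp add: algebra_simps)
    have 2: "lam_const * (ln a + ?l + 2) \<le> lam_const * ((ln a + 3) * ?l)"
      using al assms(1) lam by (intro mult_left_mono) (auto simp: algebra_simps)
    have 3: "ln 2 \<le> ln 2 * ?l" using mult_left_mono[OF assms(1), of "ln 2"] by simp
    have "(ln a + ?l) / 2 + ln 2 * c * ?l + lam_const * (ln a + ?l + 2) + ln 2 \<le> \<Gamma> * ?l"
      using 1 2 3 unfolding \<Gamma>_def by (simp only: distrib_right mult.assoc)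
    then show ?thesis using assms(1-5) by (intro add_left_mono mult_left_mono) auto
  qed
  also have "\<dots> = (- lam_const * x\<^sup>2 / s + \<Gamma> * x * log 2 x) * ln 2"
    by (simp add: X_def log_def algebra_simps)
  finally show ?thesis by (simp add: powr_def)
qed

text \<open>Both rates are O((ln m) / m); with \<open>b = ln 2\<close> this is the condition of
  \<open>high_weight_tail\<close>.\<close>

lemma eventually_small_rates:
  fixes s a b :: real
  assumes "0 < a" "0 < b"
  shows "\<forall>\<^sub>F m :: nat in sequentially. s * pi\<^sup>2 / (6 * real m * ln 2) + s / real m * (ln (a * real m) + 2) \<le> b"
proof -
  have "(\<lambda>m. (s * pi\<^sup>2 / (6 * ln 2) + s * (ln a + 2)) * (1 / real m) + s * (ln (real m) / real m)) \<longlonglongrightarrow>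
    (s * pi\<^sup>2 / (6 * ln 2) + s * (ln a + 2)) * 0 + s * 0"
    by (intro tendsto_intros lim_1_over_n lim_ln_over_n)
  then have "\<forall>\<^sub>F m in sequentially. (s * pi\<^sup>2 / (6 * ln 2) + s * (ln a + 2)) * (1 / real m) + s * (ln (real m) / real m) < b"
    using assms(2) by (intro order_tendstoD(2)) auto
  then show ?thesis
    using eventually_gt_at_top[of 0]
  proof eventually_elim
    case (elim m)
    have "s * pi\<^sup>2 / (6 * real m * ln 2) + s / real m * (ln (a * real m) + 2) =
      (s * pi\<^sup>2 / (6 * ln 2) + s * (ln a + 2)) * (1 / real m) + s * (ln (real m) / real m)"
      using assms elim(2) by (simp add: ln_mult field_simps)
    then show ?case using elim(1) by simp
  qed
qed

theorem theorem8:
  fixes \<alpha> \<gamma> :: real and Jmax :: nat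
  assumes "\<alpha> > 0" and "\<gamma> > 0"
  shows "\<exists>\<Gamma>::real. \<forall>(f :: real^'n::{finite,linorder} \<Rightarrow> real) (K::real) (\<J> :: 'n set set).
     smooth_cube f \<longrightarrow> K > 0 \<longrightarrow> \<J> \<noteq> {} \<longrightarrow> Max (card ` \<J>) = Jmax \<longrightarrow>
     (\<forall>k :: 'n \<Rightarrow> nat.
        integral (cbox 0 One) (\<lambda>x. \<bar>mixed_deriv (\<lambda>j. card (digit_set (k j))) f x\<bar>)
          \<le> K * \<alpha> ^ (\<Sum>j\<in>UNIV. card (digit_set (k j)))
               * Max ((\<lambda>J. \<Prod>j\<in>J. fact (card (digit_set (k j)))) ` \<J>)) \<longrightarrow>
     limsup (\<lambda>m. ereal (real m powr \<gamma> *
        measure design_space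
          {\<omega> \<in> space design_space.
             \<bar>mu_hat f m (fst \<omega>) (snd \<omega>) - integral (cbox 0 One) f\<bar>
               > K * 2 powr (- lam_const * (real m)^2 / real CARD('n)
                             + \<Gamma> * real m * log 2 (real m))})) \<le> 1"
proof -
  define s where "s = real CARD('n)"
  define a where "a = max \<alpha> 1"
  \<comment> \<open>Chosen so that lowering the threshold by c m ln m multiplies the probability
    bound by m^-\<gamma>.\<close>
  define c where "c = 6 * \<gamma> * ln 2 / (s * pi\<^sup>2)"
  define \<Gamma> where "\<Gamma> = (ln a + 1) / 2 + ln 2 * c + lam_const * (ln a + 3) + ln 2"
  have s: "0 < s" by (simp add: s_def)
  have a: "1 \<le> a" "\<alpha> \<le> a" by (simp_all add: a_def)
  have a0: "0 < a" and ln2: "0 < ln (2::real)" using a by simp_all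
  have c: "0 \<le> c" using assms s by (simp add: c_def)
  show ?thesis
  proof (intro exI[of _ \<Gamma>] allI impI)
    fix f :: "real^'n::{finite,linorder} \<Rightarrow> real" and K :: real and \<J> :: "'n set set"
    assume f: "smooth_cube f" and K: "K > 0" and J: "\<J> \<noteq> {}"
      and bound: "\<forall>k :: 'n \<Rightarrow> nat.
        integral (cbox 0 One) (\<lambda>x. \<bar>mixed_deriv (\<lambda>j. card (digit_set (k j))) f x\<bar>)
          \<le> K * \<alpha> ^ (\<Sum>j\<in>UNIV. card (digit_set (k j)))
               * Max ((\<lambda>J. \<Prod>j\<in>J. fact (card (digit_set (k j)))) ` \<J>)"
    let ?g = "\<lambda>x. f (clamp 0 One x)"
    let ?B = "\<lambda>m. K * 2 powr (- lam_const * (real m)^2 / real CARD('n) + \<Gamma> * real m * log 2 (real m))"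
    let ?bad = "\<lambda>m. {\<omega> \<in> space design_space.
        \<bar>mu_hat f m (fst \<omega>) (snd \<omega>) - integral (cbox 0 One) f\<bar> > ?B m}"
    interpret prob_space "design_space :: (('n \<times> nat \<times> nat \<Rightarrow> bool) \<times> ('n \<times> nat \<Rightarrow> bool)) measure"
      by (rule prob_space_design)
    have contf: "continuous_on (cbox 0 One) f"
      using f unfolding smooth_cube_def by (metis foldr.simps(1) id_apply)
    have "\<forall>\<^sub>F m in sequentially. real m powr \<gamma> * measure design_space (?bad m) \<le> 1"
      \<comment> \<open>From m \<ge> 3 > e one gets ln m \<ge> 1, as
        \<open>tail_exponent_bound\<close> demands.\<close>
      using eventually_small_rates[OF a0 ln2, of s] eventually_ge_at_top[of 3]
    proof eventually_elim
      case (elim m)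
      then have rates: "s * pi\<^sup>2 / (6 * real m * ln 2) + s / real m * (ln (a * real m) + 2) \<le> ln 2"
        and m: "m \<ge> 3" using a by auto
      define t where "t = s * pi\<^sup>2 / (6 * real m * ln 2)"
      define T where "T = lam_const * (real m)\<^sup>2 / s - c * real m * ln (real m)"
      define \<delta> where "\<delta> = s / real m * (ln (a * real m) + 2)"
      have t: "0 < t" using s m by (simp add: t_def)
      have "exp 1 \<le> real m" using exp_le m by linarith
      then have lm: "1 \<le> ln (real m)" using m by (subst ln_ge_iff) auto
      have m0: "0 < real m" using m by simp
      note id = exponent_identities[OF m0 s, folded t_def]
      let ?E = "{\<omega> \<in> space design_space. \<exists>L. \<exists>A \<subseteq> (digit_grid L :: ('n \<times> nat) set).
        A \<noteq> {} \<and> real (weight A) \<le> T \<and> annihilated m (fst \<omega>) A}"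
      note E = low_weight_annihilated_prob[OF t, where 'n='n and m=m and T=T, folded s_def]
      \<comment> \<open>Outside \<open>?E\<close> every nonempty annihilated set has weight at least
        \<open>T\<close>, and the error bound is then deterministic. Monotonicity of the measure
        asks for measurability of the larger event only.\<close>
      have "?bad m \<subseteq> ?E"
      proof (rule subsetI, rule ccontr)
        fix \<omega> assume bad: "\<omega> \<in> ?bad m" and "\<omega> \<notin> ?E"
        have high: "T \<le> real (weight A)"
          if "A \<subseteq> digit_grid L" "A \<noteq> {}" "annihilated m (fst \<omega>) A" for L A
        proof (rule ccontr)
          assume "\<not> T \<le> real (weight A)"
          then have "real (weight A) \<le> T" by simp
          moreover have "\<omega> \<in> space design_space" using bad by simp
          ultimately have "\<omega> \<in> ?E" using that by blast
          then show False using \<open>\<omega> \<notin> ?E\<close> by contradiction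
        qed
        have "\<bar>mu_hat f m (fst \<omega>) (snd \<omega>) - integral (cbox 0 One) f\<bar> \<le> ?B m"
        proof (rule error_bound[OF contf])
          fix L
          let ?S = "{A. A \<subseteq> digit_grid L \<and> A \<noteq> {} \<and> annihilated m (fst \<omega>) A}"
          have "(\<Sum>A\<in>?S. \<bar>walsh ?g L A\<bar>) \<le>
            K * exp (real m * ln (a * real m) / 2 - (ln 2 - \<delta> - t) * T + real CARD('n) * pi\<^sup>2 / (12 * t))"
          proof (rule high_weight_tail[OF K t])
            show "t + \<delta> \<le> ln 2" using rates by (simp add: t_def \<delta>_def)
            show "?S \<subseteq> Pow (digit_grid L)" by auto
            then show "finite ?S" by (rule finite_subset) simp
            fix A assume A: "A \<in> ?S"
            then show "T \<le> real (weight A)" using high by blast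
            have "\<bar>walsh ?g L A\<bar> \<le> K * (1 / 2) ^ weight A * (\<alpha> ^ card A * fact (card A))"
              using walsh_coefficient_bound[OF f K assms(1) J spec[OF bound]] A by blast
            also have "\<dots> \<le> K * (1 / 2) ^ weight A * exp (real m * ln (a * real m) / 2 + \<delta> * real (weight A))"
              using A m K a assms unfolding \<delta>_def s_def by (intro mult_left_mono power_fact_bound) auto
            finally show "\<bar>walsh ?g L A\<bar> \<le> K * (1 / 2) ^ weight A * exp (real m * ln (a * real m) / 2 + \<delta> * real (weight A))" .
          qed
          also have "\<dots> \<le> ?B m"
            using tail_exponent_bound[OF lm m0 s a(1) c] K
            unfolding t_def T_def \<delta>_def \<Gamma>_def s_def by (intro mult_left_mono) auto
          finally show "(\<Sum>A\<in>?S. \<bar>walsh ?g L A\<bar>) \<le> ?B m" .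
        qed
        then show False using bad by simp
      qed
      then have "measure design_space (?bad m) \<le> measure design_space ?E"
        by (rule finite_measure_mono[OF _ E(1)])
      also have "\<dots> \<le> exp (t * T + s * pi\<^sup>2 / (12 * t)) / 2 ^ m" by (rule E(2))
      \<comment> \<open>The two halves of m ln 2 cancel \<open>2 ^ m\<close>, leaving exactly
        m^-\<gamma>.\<close>
      also have "t * T + s * pi\<^sup>2 / (12 * t) = real m * ln 2 - \<gamma> * ln (real m)"
        unfolding T_def right_diff_distrib id c_def by simp
      also have "exp (real m * ln 2 - \<gamma> * ln (real m)) / 2 ^ m = 1 / (real m powr \<gamma>)"
        using m by (simp add: exp_diff exp_of_nat_mult powr_def)
      finally show ?case using m by (simp add: field_simps)
    qed
    then show "limsup (\<lambda>m. ereal (real m powr \<gamma> * measure design_space (?bad m))) \<le> 1"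
      by (intro Limsup_bounded) (auto elim!: eventually_mono)
  qed
qed

end
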